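(* Let $G$ be a finite simple graph that is vertex-transitive, edge-transitive, and has at least one edge, and let $\delta\in[0,1]$. Then $$R^*(G,\delta)\ \le\ \log\theta_L(G)+R_{LP1}\!\left(\frac{|V(G)|}{\theta_L(G)},\,\delta\right),$$ where $\theta_L(G)$ is the Lovász theta function of $G$.
   Context: For a finite simple graph $G$, define $d_G$ on $V(G)$ by $d_G(v,v')=0$ if $v=v'$, $d_G(v,v')=1$ if $\{v,v'\}\in E(G)$, and $d_G(v,v')=\infty$ otherwise. Extend it additively to $V(G)^n$: $d_G(x,x')=\sum_{j=1}^n d_G(x_j,x'_j)$. For $n\ge 1$ and real $d\ge 0$, $G(n,d)$ is the simple graph with vertex set $V(G)^n$ in which distinct $x,x'$ are adjacent iff $d_G(x,x')\le d$. For real $\delta\ge 0$, $R^*(G,\delta)=\limsup_{n\to\infty}\frac1n\log\alpha(G(n,\delta n))$, where $\alpha$ denotes the size of a largest independent set. Logarithms are to a fixed base greater than $1$. The Lovász theta function is $$\theta_L(G)=\min\left\{\max_{v}T_{v,v}:\ T\succcurlyeq \mathbf 1\mathbf 1^T,\ T_{v,v'}=0\ \text{for all } v\ne v' \text{ with } \{v,v'\}\notin E(G)\right\},$$ where $T$ ranges over real symmetric matrices indexed by $V(G)$, $\mathbf 1$ is the all-ones column vector, and $T\succcurlyeq T'$ means that $T-T'$ is positive semidefinite. For real $q>1$ (not necessarily an integer) and $\delta\in[0,1]$: $$R_{LP1}(q,\delta)=H_q\!\left(\frac{(q-1)-(q-2)\delta-2\sqrt{(q-1)\delta(1-\delta)}}{q}\right)\quad\text{if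 }\delta<1-\tfrac1q,$$ and $R_{LP1}(q,\delta)=0$ if $\delta\ge 1-\frac1q$, where $H_q(x)=x\log(q-1)-x\log x-(1-x)\log(1-x)$ with $0\log 0=0$. A graph is vertex-transitive (resp. edge-transitive) if its automorphism group acts transitively on its vertex set (resp. on its set of undirected edges). *)

theory Defs
  imports "HOL-Analysis.Analysis" "Graph_Theory.Pair_Digraph"
begin

text \<open>
  A finite simple graph is a \<open>pair_graph\<close>: finite vertex set, symmetric and loop-free set of arcs.
  The undirected edge \<open>{u, v}\<close> is represented by the two arcs \<open>(u, v)\<close> and \<open>(v, u)\<close>.
  Logarithms are taken to an arbitrary fixed base \<open>b > 1\<close>, passed as a parameter.
\<close>

definition edge_set :: "'a pair_pre_digraph \<Rightarrow> 'a set set" where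
  "edge_set G = {{u, v} | u v. (u, v) \<in> parcs G}"

definition automorphism :: "'a pair_pre_digraph \<Rightarrow> ('a \<Rightarrow> 'a) \<Rightarrow> bool" where
  "automorphism G f \<longleftrightarrow>
     bij_betw f (pverts G) (pverts G) \<and>
     (\<forall>u\<in>pverts G. \<forall>v\<in>pverts G. (f u, f v) \<in> parcs G \<longleftrightarrow> (u, v) \<in> parcs G)"

definition vertex_transitive :: "'a pair_pre_digraph \<Rightarrow> bool" where
  "vertex_transitive G \<longleftrightarrow>
     (\<forall>u\<in>pverts G. \<forall>v\<in>pverts G. \<exists>f. automorphism G f \<and> f u = v)"

definition edge_transitive :: "'a pair_pre_digraph \<Rightarrow> bool" where
  "edge_transitive G \<longleftrightarrow>
     (\<forall>e\<in>edge_set G. \<forall>e'\<in>edge_set G. \<exists>f. automorphism G f \<and> f ` e = e')"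

definition independent_set :: "'a pair_pre_digraph \<Rightarrow> 'a set \<Rightarrow> bool" where
  "independent_set G S \<longleftrightarrow> S \<subseteq> pverts G \<and> (\<forall>u\<in>S. \<forall>v\<in>S. (u, v) \<notin> parcs G)"

definition independence_number :: "'a pair_pre_digraph \<Rightarrow> nat" where
  "independence_number G = Max (card ` {S. independent_set G S})"

definition vdist :: "'a pair_pre_digraph \<Rightarrow> 'a \<Rightarrow> 'a \<Rightarrow> ereal" where
  "vdist G v w = (if v = w then 0 else if (v, w) \<in> parcs G then 1 else \<infinity>)"

definition tuple_dist :: "'a pair_pre_digraph \<Rightarrow> nat \<Rightarrow> (nat \<Rightarrow> 'a) \<Rightarrow> (nat \<Rightarrow> 'a) \<Rightarrow> ereal" where
  "tuple_dist G n x y = (\<Sum>j<n. vdist G (x j) (y j))"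

definition power_graph :: "'a pair_pre_digraph \<Rightarrow> nat \<Rightarrow> real \<Rightarrow> (nat \<Rightarrow> 'a) pair_pre_digraph" where
  "power_graph G n d =
     (let V = {..<n} \<rightarrow>\<^sub>E pverts G
      in \<lparr> pverts = V,
           parcs = {(x, y). x \<in> V \<and> y \<in> V \<and> x \<noteq> y \<and> tuple_dist G n x y \<le> ereal d} \<rparr>)"

definition R_star :: "real \<Rightarrow> 'a pair_pre_digraph \<Rightarrow> real \<Rightarrow> ereal" where
  "R_star b G \<delta> =
     limsup (\<lambda>n. ereal (1 / real n * log b (real (independence_number (power_graph G n (\<delta> * real n))))))"

text \<open>Real matrices indexed by \<open>V\<close> are functions of which only the values on \<open>V \<times> V\<close> matter.\<close>

definition psd_on :: "'a set \<Rightarrow> ('a \<Rightarrow> 'a \<Rightarrow> real) \<Rightarrow> bool" where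
  "psd_on V T \<longleftrightarrow>
     (\<forall>u\<in>V. \<forall>v\<in>V. T u v = T v u) \<and>
     (\<forall>x. (\<Sum>u\<in>V. \<Sum>v\<in>V. x u * T u v * x v) \<ge> 0)"

definition theta_feasible :: "'a pair_pre_digraph \<Rightarrow> ('a \<Rightarrow> 'a \<Rightarrow> real) \<Rightarrow> bool" where
  "theta_feasible G T \<longleftrightarrow>
     psd_on (pverts G) (\<lambda>u v. T u v - 1) \<and>
     (\<forall>u\<in>pverts G. \<forall>v\<in>pverts G. u \<noteq> v \<and> (u, v) \<notin> parcs G \<longrightarrow> T u v = 0)"

definition theta_value :: "'a pair_pre_digraph \<Rightarrow> ('a \<Rightarrow> 'a \<Rightarrow> real) \<Rightarrow> real" where
  "theta_value G T = Max ((\<lambda>v. T v v) ` pverts G)"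

text \<open>
  The infimum is a minimum, see \<open>lovasz_theta_attained\<close> and \<open>lovasz_theta_le\<close> below.
  In this convention \<open>T\<close> vanishes on the non-edges, so complete graphs have value \<open>1\<close>.
\<close>

definition lovasz_theta :: "'a pair_pre_digraph \<Rightarrow> real" where
  "lovasz_theta G = Inf {theta_value G T | T. theta_feasible G T}"

text \<open>The convention \<open>0 log 0 = 0\<close> holds automatically, since \<open>0 * log b 0 = 0\<close>.\<close>

definition H_entropy :: "real \<Rightarrow> real \<Rightarrow> real \<Rightarrow> real" where
  "H_entropy b q x = x * log b (q - 1) - x * log b x - (1 - x) * log b (1 - x)"

definition R_LP1 :: "real \<Rightarrow> real \<Rightarrow> real \<Rightarrow> real" where
  "R_LP1 b q \<delta> =
     (if \<delta> < 1 - 1 / q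
      then H_entropy b q (((q - 1) - (q - 2) * \<delta> - 2 * sqrt ((q - 1) * \<delta> * (1 - \<delta>))) / q)
      else 0)"

lemma pair_graph_power_graph:
  assumes "pair_graph G"
  shows "pair_graph (power_graph G n d)"
proof -
  interpret pair_graph G by fact
  have vd: "vdist G v w = vdist G w v" for v w
    using pair_sym_arcs by (auto simp: vdist_def symmetric_def dest: symD)
  have td: "tuple_dist G n x y = tuple_dist G n y x" for x y
    by (simp add: tuple_dist_def vd)
  have fin: "finite ({..<n} \<rightarrow>\<^sub>E pverts G)"
    by (intro finite_PiE) auto
  let ?P = "power_graph G n d" and ?V = "{..<n} \<rightarrow>\<^sub>E pverts G"
  have verts: "pverts ?P = ?V"
    by (simp add: power_graph_def Let_def)
  have arcs: "(x, y) \<in> parcs ?P \<longleftrightarrow> x \<in> ?V \<and> y \<in> ?V \<and> x \<noteq> y \<and> tuple_dist G n x y \<le> ereal d" for x y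
    by (simp add: power_graph_def Let_def)
  have sub: "parcs ?P \<subseteq> ?V \<times> ?V"
    unfolding subset_iff by (metis arcs mem_Sigma_iff surj_pair)
  have "sym (parcs ?P)"
    by (rule symI) (metis arcs td)
  then have symm: "symmetric (with_proj ?P)"
    by (simp add: symmetric_def)
  show ?thesis
  proof unfold_locales
    show "fst e \<in> pverts ?P" "snd e \<in> pverts ?P" if "e \<in> parcs ?P" for e
      unfolding verts using subsetD[OF sub that] by (simp_all only: mem_Times_iff)
    show "finite (pverts ?P)"
      unfolding verts by (rule fin)
    show "finite (parcs ?P)"
      by (rule finite_subset[OF sub finite_cartesian_product[OF fin fin]])
    show "fst e \<noteq> snd e" if "e \<in> parcs ?P" for e
      using that arcs[of "fst e" "snd e"] by simp
    show "symmetric (with_proj ?P)"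
      by (rule symm)
  qed
qed

lemma psd_onD:
  assumes "psd_on V S"
  shows "(\<Sum>u\<in>V. \<Sum>v\<in>V. x u * S u v * x v) \<ge> 0"
  using assms by (simp add: psd_on_def)

lemma psd_on_diag:
  assumes "finite V" "psd_on V S" "u \<in> V"
  shows "S u u \<ge> 0"
proof -
  have "0 \<le> (\<Sum>a\<in>V. \<Sum>c\<in>V. (if a = u then 1 else 0) * S a c * (if c = u then 1 else 0))"
    by (rule psd_onD[OF assms(2)])
  also have "\<dots> = S u u"
    using assms by (simp add: if_distrib[of "\<lambda>t. t * _"] if_distrib[of "(*) _"] sum.delta cong: if_cong)
  finally show ?thesis .
qed

lemma psd_on_offdiag:
  assumes "finite V" "psd_on V S" "u \<in> V" "v \<in> V"
  shows "2 * \<bar>S u v\<bar> \<le> S u u + S v v"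
proof -
  have "0 \<le> S u u + s * S u v + s * S v u + s * s * S v v" for s
  proof -
    let ?x = "\<lambda>a. (if a = u then 1 else 0) + s * (if a = v then 1 else 0)"
    have "0 \<le> (\<Sum>a\<in>V. \<Sum>c\<in>V. ?x a * S a c * ?x c)"
      by (rule psd_onD[OF assms(2)])
    also have "\<dots> = (\<Sum>a\<in>V. ?x a * (\<Sum>c\<in>V. S a c * ?x c))"
      by (simp add: sum_distrib_left mult.assoc)
    also have "\<dots> = (\<Sum>a\<in>V. ?x a * (S a u + s * S a v))"
    proof (intro sum.cong refl arg_cong[of _ _ "(*) _"])
      fix a
      have "(\<Sum>c\<in>V. S a c * ?x c) = (\<Sum>c\<in>V. (if c = u then S a c else 0) + (if c = v then s * S a c else 0))"
        by (intro sum.cong) (auto simp: algebra_simps)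
      then show "(\<Sum>c\<in>V. S a c * ?x c) = S a u + s * S a v"
        using assms by (simp add: sum.distrib)
    qed
    also have "\<dots> = (\<Sum>a\<in>V. (if a = u then S a u + s * S a v else 0)
        + (if a = v then s * (S a u + s * S a v) else 0))"
      by (intro sum.cong) (auto simp: algebra_simps)
    also have "\<dots> = S u u + s * S u v + s * S v u + s * s * S v v"
      using assms by (simp add: sum.distrib algebra_simps)
    finally show ?thesis .
  qed
  from this[of 1] this[of "-1"] show ?thesis
    using assms unfolding psd_on_def by auto
qed

lemma convergent_subseq_finite:
  fixes f :: "nat \<Rightarrow> 'i \<Rightarrow> real"
  assumes "finite I" "\<And>i. i \<in> I \<Longrightarrow> bounded (range (\<lambda>k. f k i))"
  shows "\<exists>r L. strict_mono r \<and> (\<forall>i\<in>I. (\<lambda>k. f (r k) i) \<longlonglongrightarrow> L i)"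
  using assms
proof (induction I rule: finite_induct)
  case empty
  then show ?case by (auto intro!: exI[of _ id] strict_mono_id)
next
  case (insert j I)
  then obtain r L where r: "strict_mono r" "\<forall>i\<in>I. (\<lambda>k. f (r k) i) \<longlonglongrightarrow> L i"
    by auto
  have "bounded (range (\<lambda>k. f (r k) j))"
    by (rule bounded_subset[OF insert.prems[of j]]) auto
  from bounded_imp_convergent_subsequence[OF this]
  obtain l s where s: "strict_mono s" "((\<lambda>k. f (r k) j) \<circ> s) \<longlonglongrightarrow> l"
    by blast
  have "\<forall>i\<in>insert j I. (\<lambda>k. f ((r \<circ> s) k) i) \<longlonglongrightarrow> (L(j := l)) i"
  proof
    fix i assume "i \<in> insert j I"
    show "(\<lambda>k. f ((r \<circ> s) k) i) \<longlonglongrightarrow> (L(j := l)) i"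
    proof (cases "i = j")
      case True
      then show ?thesis using s(2) by (simp add: o_def)
    next
      case False
      then have "(\<lambda>k. f (r k) i) \<longlonglongrightarrow> L i" using r \<open>i \<in> insert j I\<close> by auto
      from LIMSEQ_subseq_LIMSEQ[OF this s(1)] False show ?thesis by (simp add: o_def)
    qed
  qed
  with strict_mono_o[OF r(1) s(1)] show ?case by blast
qed

lemma theta_value_ge:
  assumes "finite (pverts G)" "v \<in> pverts G"
  shows "T v v \<le> theta_value G T"
  using assms by (simp add: theta_value_def)

lemma theta_feasible_diag:
  assumes "finite (pverts G)" "v \<in> pverts G" "theta_feasible G T"
  shows "1 \<le> T v v"
  using psd_on_diag[of "pverts G" "\<lambda>u v. T u v - 1" v] assms by (auto simp: theta_feasible_def)

lemma theta_value_bdd_below: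
  assumes "finite (pverts G)" "pverts G \<noteq> {}"
  shows "bdd_below {theta_value G T | T. theta_feasible G T}"
proof (rule bdd_belowI)
  fix t assume "t \<in> {theta_value G T | T. theta_feasible G T}"
  then obtain T where T: "t = theta_value G T" "theta_feasible G T" by auto
  obtain v where "v \<in> pverts G" using assms(2) by auto
  with theta_feasible_diag[OF assms(1) _ T(2)] theta_value_ge[OF assms(1), of v T]
  show "1 \<le> t" unfolding T(1) by fastforce
qed

lemma theta_feasible_exists:
  assumes "finite (pverts G)"
  shows "\<exists>T. theta_feasible G T"
proof -
  let ?V = "pverts G"
  let ?T = "\<lambda>u v. if u = v then real (card ?V) else 0"
  have "0 \<le> (\<Sum>u\<in>?V. \<Sum>v\<in>?V. x u * (?T u v - 1) * x v)" for x :: "'a \<Rightarrow> real"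
  proof -
    have "(\<Sum>u\<in>?V. \<Sum>v\<in>?V. x u * (?T u v - 1) * x v)
        = (\<Sum>u\<in>?V. (\<Sum>v\<in>?V. if u = v then real (card ?V) * (x u * x v) else 0))
          - (\<Sum>u\<in>?V. \<Sum>v\<in>?V. x u * x v)"
      unfolding sum_subtractf[symmetric] by (intro sum.cong) (auto simp: algebra_simps)
    also have "\<dots> = real (card ?V) * (\<Sum>u\<in>?V. (x u)\<^sup>2) - (\<Sum>u\<in>?V. x u)\<^sup>2"
    proof -
      have "(\<Sum>u\<in>?V. \<Sum>v\<in>?V. x u * x v) = (\<Sum>u\<in>?V. x u)\<^sup>2"
        by (simp only: power2_eq_square sum_product)
      moreover have "(\<Sum>u\<in>?V. (\<Sum>v\<in>?V. if u = v then real (card ?V) * (x u * x v) else 0))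
          = real (card ?V) * (\<Sum>u\<in>?V. (x u)\<^sup>2)"
        using assms by (simp add: power2_eq_square sum_distrib_left)
      ultimately show ?thesis by simp
    qed
    also have "\<dots> \<ge> 0"
      using sum_squared_le_sum_of_squares[of x ?V] by (simp add: mult.commute)
    finally show ?thesis .
  qed
  then have "theta_feasible G ?T"
    by (auto simp: theta_feasible_def psd_on_def)
  then show ?thesis by blast
qed

lemma lovasz_theta_le:
  assumes "finite (pverts G)" "pverts G \<noteq> {}" "theta_feasible G T"
  shows "lovasz_theta G \<le> theta_value G T"
  unfolding lovasz_theta_def
  by (rule cInf_lower[OF _ theta_value_bdd_below[OF assms(1,2)]]) (use assms in blast)

lemma lovasz_theta_attained:
  assumes fin: "finite (pverts G)" and ne: "pverts G \<noteq> {}"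
  shows "\<exists>T. theta_feasible G T \<and> theta_value G T = lovasz_theta G"
proof -
  let ?V = "pverts G" and ?t = "lovasz_theta G"
  have "\<exists>T. theta_feasible G T \<and> theta_value G T < ?t + 1 / real (Suc k)" for k
  proof -
    have "Inf {theta_value G T | T. theta_feasible G T} < ?t + 1 / real (Suc k)"
      by (simp add: lovasz_theta_def)
    then show ?thesis
      using theta_feasible_exists[OF fin] theta_value_bdd_below[OF fin ne]
      by (subst (asm) cInf_less_iff) auto
  qed
  then obtain T where T: "\<And>k. theta_feasible G (T k)"
      "\<And>k. theta_value G (T k) < ?t + 1 / real (Suc k)"
    by metis
  have bd: "bounded (range (\<lambda>k. T k (fst p) (snd p)))" if p: "p \<in> ?V \<times> ?V" for p
  proof -
    obtain u v where uv: "p = (u, v)" "u \<in> ?V" "v \<in> ?V" using p by auto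
    have "\<bar>T k u v\<bar> \<le> \<bar>?t\<bar> + 2" for k
    proof -
      have "2 * \<bar>T k u v - 1\<bar> \<le> (T k u u - 1) + (T k v v - 1)"
        using psd_on_offdiag[OF fin _ uv(2,3), of "\<lambda>u v. T k u v - 1"] T(1)[of k]
        by (auto simp: theta_feasible_def)
      moreover have "theta_value G (T k) < ?t + 1"
      proof -
        have "1 / real (Suc k) \<le> 1" by simp
        with T(2)[of k] show ?thesis by linarith
      qed
      moreover note theta_value_ge[OF fin uv(2), of "T k"] theta_value_ge[OF fin uv(3), of "T k"]
      moreover have "d < ?t" if "2 * d \<le> b - 1 + (c - 1)" "h < ?t + 1" "b \<le> h" "c \<le> h"
        for b c d h :: real using that by linarith
      ultimately have "\<bar>T k u v - 1\<bar> < ?t" by blast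
      then show ?thesis by linarith
    qed
    then show ?thesis
      unfolding bounded_iff uv(1) by auto
  qed
  obtain r L where r: "strict_mono r"
      and L0: "\<forall>p\<in>?V \<times> ?V. (\<lambda>k. T (r k) (fst p) (snd p)) \<longlonglongrightarrow> L p"
    using convergent_subseq_finite[of "?V \<times> ?V" "\<lambda>k p. T k (fst p) (snd p)"] bd fin
    by auto
  define M where "M u v = L (u, v)" for u v
  have lim: "(\<lambda>k. T (r k) u v) \<longlonglongrightarrow> M u v" if "u \<in> ?V" "v \<in> ?V" for u v
    using L0 that by (auto simp: M_def)
  have "psd_on ?V (\<lambda>u v. M u v - 1)"
    unfolding psd_on_def
  proof (intro conjI ballI allI)
    fix u v assume uv: "u \<in> ?V" "v \<in> ?V"
    have "(\<lambda>k. T (r k) u v) = (\<lambda>k. T (r k) v u)"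
      using T(1) uv by (auto simp: theta_feasible_def psd_on_def)
    then show "M u v - 1 = M v u - 1"
      using lim[OF uv] lim[OF uv(2,1)] LIMSEQ_unique by metis
  next
    fix x :: "'a \<Rightarrow> real"
    have "(\<lambda>k. \<Sum>u\<in>?V. \<Sum>v\<in>?V. x u * (T (r k) u v - 1) * x v)
        \<longlonglongrightarrow> (\<Sum>u\<in>?V. \<Sum>v\<in>?V. x u * (M u v - 1) * x v)"
      by (intro tendsto_intros lim)
    moreover have "0 \<le> (\<Sum>u\<in>?V. \<Sum>v\<in>?V. x u * (T (r k) u v - 1) * x v)" for k
      using T(1)[of "r k"] unfolding theta_feasible_def psd_on_def by blast
    ultimately show "0 \<le> (\<Sum>u\<in>?V. \<Sum>v\<in>?V. x u * (M u v - 1) * x v)"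
      by (intro LIMSEQ_le_const) auto
  qed
  moreover have "M u v = 0" if "u \<in> ?V" "v \<in> ?V" "u \<noteq> v" "(u, v) \<notin> parcs G" for u v
  proof -
    have "(\<lambda>k. T (r k) u v) = (\<lambda>k. 0)"
      using T(1) that by (auto simp: theta_feasible_def)
    with lim[OF that(1,2)] show ?thesis
      by (metis LIMSEQ_unique tendsto_const)
  qed
  ultimately have feas: "theta_feasible G M"
    by (auto simp: theta_feasible_def)
  have "M v v \<le> ?t" if v: "v \<in> ?V" for v
  proof (rule LIMSEQ_le[OF lim[OF v v]])
    have "(\<lambda>k. ?t + 1 / real (Suc k)) \<longlonglongrightarrow> ?t + 0"
      by (intro tendsto_add tendsto_const LIMSEQ_Suc[OF lim_1_over_n])
    from LIMSEQ_subseq_LIMSEQ[OF this r]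
    show "(\<lambda>k. ?t + 1 / real (Suc (r k))) \<longlonglongrightarrow> ?t" by (simp add: o_def)
    show "\<exists>N. \<forall>k\<ge>N. T (r k) v v \<le> ?t + 1 / real (Suc (r k))"
      using theta_value_ge[OF fin v] T(2) by (meson less_imp_le order_trans)
  qed
  then have "theta_value G M \<le> ?t"
    using fin ne by (simp add: theta_value_def)
  with lovasz_theta_le[OF fin ne feas] feas show ?thesis by fastforce
qed

end

theory Submission
  imports Defs "HOL-Real_Asymp.Real_Asymp"
begin

text \<open>
  Averaging an optimal \<open>T\<close> over the automorphism group gives \<open>\<theta> * I + c * A\<close> with \<open>A\<close> the adjacency
  matrix, and optimality forces all row sums to be \<open>card V\<close>. Put \<open>q = card V / \<theta>\<close> and \<open>B = (c / \<theta>) * A\<close>.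
  Then \<open>I + B\<close> dominates \<open>J / \<theta>\<close> and \<open>(q - 1) * I - B\<close> is positive semidefinite, so these two matrices
  can replace the matrices \<open>J\<close> and \<open>q * I - J\<close> of the \<open>q\<close>-ary Hamming scheme: tensor products of them
  are positive semidefinite kernels on \<open>V ^ n\<close> whose entries, on pairs of tuples that are equal or adjacent
  in every coordinate, are Krawtchouk-type characters times a nonnegative weight, and which vanish on the other
  pairs. Every linear programming bound for \<open>q\<close>-ary codes, even with \<open>q\<close> not an integer, therefore transfers to
  \<open>G\<close> at the cost of replacing \<open>q ^ n\<close> by \<open>card V ^ n\<close>, i.e. of a factor \<open>\<theta> ^ n\<close>.

  For the auxiliary function of McEliece, Rodemich, Rumsey and Welch one needs \<open>(K\<^sub>1 - c) * g ^ 2\<close> with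
  \<open>g\<close> a nonnegative combination of characters of degree at most \<open>\<tau> n\<close> that is an approximate
  eigenvector of the multiplication by \<open>K\<^sub>1\<close>; no zeros of Krawtchouk polynomials enter. The bound is then the
  volume of a ball of radius \<open>\<tau> n\<close>, and \<open>\<tau>\<close> tends to the argument of the entropy in the first
  linear programming bound.
\<close>

section \<open>Positive semidefinite kernels\<close>

lemma psd_on_add:
  assumes "psd_on V K" "psd_on V L"
  shows "psd_on V (\<lambda>u v. K u v + L u v)"
  using assms by (auto simp: psd_on_def algebra_simps sum.distrib intro!: add_nonneg_nonneg)

lemma psd_on_scale:
  assumes "psd_on V K" "0 \<le> c"
  shows "psd_on V (\<lambda>u v. c * K u v)"
proof -
  have "(\<Sum>u\<in>V. \<Sum>v\<in>V. x u * (c * K u v) * x v) = c * (\<Sum>u\<in>V. \<Sum>v\<in>V. x u * K u v * x v)" for x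
    by (simp add: sum_distrib_left mult_ac)
  with assms show ?thesis by (simp add: psd_on_def)
qed

lemma psd_on_const:
  assumes "0 \<le> c"
  shows "psd_on V (\<lambda>u v. c)"
proof -
  have "(\<Sum>u\<in>V. \<Sum>v\<in>V. x u * c * x v) = c * (\<Sum>u\<in>V. x u)\<^sup>2" for x
    by (simp add: power2_eq_square sum_product sum_distrib_left mult_ac)
  with assms show ?thesis by (simp add: psd_on_def)
qed

lemma psd_on_cong:
  assumes "\<And>u v. u \<in> V \<Longrightarrow> v \<in> V \<Longrightarrow> K u v = L u v"
  shows "psd_on V K \<longleftrightarrow> psd_on V L"
  using assms by (simp add: psd_on_def cong: sum.cong)

lemma quadratic_form_insert:
  fixes K :: "'a \<Rightarrow> 'a \<Rightarrow> real"
  assumes "finite V" "w \<notin> V" and sym: "\<And>v. v \<in> V \<Longrightarrow> K v w = K w v"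
  shows "(\<Sum>u\<in>insert w V. \<Sum>v\<in>insert w V. x u * K u v * x v)
    = (x w)\<^sup>2 * K w w + 2 * x w * (\<Sum>v\<in>V. K w v * x v) + (\<Sum>u\<in>V. \<Sum>v\<in>V. x u * K u v * x v)"
proof -
  have "(\<Sum>u\<in>V. x u * K u w * x w) = x w * (\<Sum>v\<in>V. K w v * x v)"
    using sym by (simp add: sum_distrib_left mult_ac)
  moreover have "(\<Sum>v\<in>V. x w * K w v * x v) = x w * (\<Sum>v\<in>V. K w v * x v)"
    by (simp add: sum_distrib_left mult_ac)
  ultimately show ?thesis
    using assms(1,2) by (simp add: sum.distrib power2_eq_square algebra_simps)
qed

text \<open>Cholesky decomposition: a point \<open>w\<close> is split off, its row supplies one
  coordinate of the Gram vectors, and the induction continues with the Schur complement on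
  \<open>V\<close>.\<close>

lemma psd_on_gram:
  assumes "finite V" "psd_on V K"
  shows "\<exists>(m::nat) a. \<forall>u\<in>V. \<forall>v\<in>V. K u v = (\<Sum>k<m. a k u * a k v)"
  using assms
proof (induction V arbitrary: K rule: finite_induct)
  case empty
  then show ?case by simp
next
  case (insert w V)
  define L where "L x = (\<Sum>v\<in>V. K w v * x v)" for x
  define Q where "Q x = (\<Sum>u\<in>V. \<Sum>v\<in>V. x u * K u v * x v)" for x
  have sym: "K u v = K v u" if "u \<in> insert w V" "v \<in> insert w V" for u v
    using insert.prems that unfolding psd_on_def by blast
  have form: "0 \<le> s\<^sup>2 * K w w + 2 * s * L x + Q x" for s x
  proof -
    let ?y = "x(w := s)"
    have "0 \<le> (\<Sum>u\<in>insert w V. \<Sum>v\<in>insert w V. ?y u * K u v * ?y v)"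
      by (rule psd_onD[OF insert.prems])
    also have "\<dots> = (?y w)\<^sup>2 * K w w + 2 * ?y w * (\<Sum>v\<in>V. K w v * ?y v)
        + (\<Sum>u\<in>V. \<Sum>v\<in>V. ?y u * K u v * ?y v)"
      using insert.hyps sym by (intro quadratic_form_insert) auto
    also have "(\<Sum>v\<in>V. K w v * ?y v) = L x"
      unfolding L_def using insert.hyps by (intro sum.cong) auto
    also have "(\<Sum>u\<in>V. \<Sum>v\<in>V. ?y u * K u v * ?y v) = Q x"
      unfolding Q_def using insert.hyps by (intro sum.cong) auto
    also have "?y w = s" by simp
    finally show ?thesis .
  qed
  have diag: "0 \<le> K w w"
    using insert by (intro psd_on_diag[of "insert w V"]) auto
  have L0: "L x = 0" if "K w w = 0" for x
  proof (rule ccontr)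
    assume "L x \<noteq> 0"
    \<comment> \<open>With \<open>K w w = 0\<close> the form is affine in \<open>s\<close>, and this
      value of \<open>s\<close> makes it \<open>-1\<close>.\<close>
    with form[of "- (Q x + 1) / (2 * L x)" x] that show False by (simp add: field_simps)
  qed
  have row0: "K w v = 0" if "K w w = 0" "v \<in> V" for v
    using L0[of "\<lambda>u. if u = v then 1 else 0"] that insert.hyps
    by (simp add: L_def if_distrib[of "(*) _"] cong: if_cong)
  \<comment> \<open>The Schur complement. If \<open>K w w = 0\<close>, the convention
    \<open>x / 0 = 0\<close> leaves \<open>K\<close> unchanged, which is right because the row of
    \<open>w\<close> then vanishes.\<close>
  define K' where "K' u v = K u v - K w u * K w v / K w w" for u v
  have "psd_on V K'"
    unfolding psd_on_def
  proof (intro conjI ballI allI)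
    fix u v assume "u \<in> V" "v \<in> V"
    then show "K' u v = K' v u" using sym by (simp add: K'_def)
  next
    fix x
    have "(\<Sum>u\<in>V. \<Sum>v\<in>V. x u * K' u v * x v)
        = Q x - (\<Sum>u\<in>V. \<Sum>v\<in>V. (K w u * x u) * (K w v * x v)) / K w w"
      unfolding Q_def K'_def sum_divide_distrib sum_subtractf[symmetric]
      by (intro sum.cong) (auto simp: algebra_simps)
    also have "\<dots> = Q x - (L x)\<^sup>2 / K w w"
      by (simp add: L_def power2_eq_square sum_product)
    also have "\<dots> \<ge> 0"
    proof (cases "K w w = 0")
      case True
      with form[of 0 x] show ?thesis by simp
    next
      case False
      \<comment> \<open>This is the minimiser in \<open>s\<close>, with minimum
        \<open>Q x - (L x)\<^sup>2 / K w w\<close>.\<close>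
      with form[of "- L x / K w w" x] show ?thesis
        by (simp add: field_simps power2_eq_square)
    qed
    finally show "0 \<le> (\<Sum>u\<in>V. \<Sum>v\<in>V. x u * K' u v * x v)" .
  qed
  then obtain m a where
    a: "\<forall>u\<in>V. \<forall>v\<in>V. K' u v = (\<Sum>k<(m::nat). a k u * a k v)"
    using insert.IH by blast
  define a' where "a' k u = (if k < m then if u = w then 0 else a k u else K w u / sqrt (K w w))" for k u
  have "K u v = (\<Sum>k<Suc m. a' k u * a' k v)" if uv: "u \<in> insert w V" "v \<in> insert w V" for u v
  proof -
    have last: "a' m u * a' m v = K w u * K w v / K w w"
      using diag by (simp add: a'_def)
    show ?thesis
    proof (cases "u = w \<or> v = w")
      case True
      then have "(\<Sum>k<m. a' k u * a' k v) = 0" by (auto simp: a'_def)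
      moreover have "K u v = K w u * K w v / K w w"
        using True uv sym[OF uv] row0 by (cases "K w w = 0") auto
      ultimately show ?thesis by (simp add: last)
    next
      case False
      then have "(\<Sum>k<m. a' k u * a' k v) = K' u v" using a uv by (simp add: a'_def)
      then show ?thesis by (simp add: last K'_def)
    qed
  qed
  then show ?case by blast
qed

text \<open>With \<open>f\<close> the identity this is Schur's product theorem.\<close>

lemma psd_on_mult_pullback:
  assumes C: "finite C" "psd_on C K" and V: "finite V" "psd_on V L" and f: "f ` C \<subseteq> V"
  shows "psd_on C (\<lambda>x y. K x y * L (f x) (f y))"
proof -
  obtain m a where a: "\<forall>u\<in>V. \<forall>v\<in>V. L u v = (\<Sum>k<(m::nat). a k u * a k v)"
    using psd_on_gram[OF V] by blast
  have "0 \<le> (\<Sum>x\<in>C. \<Sum>y\<in>C. z x * (K x y * L (f x) (f y)) * z y)" for z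
  proof -
    have "0 \<le> (\<Sum>k<m. \<Sum>x\<in>C. \<Sum>y\<in>C. (z x * a k (f x)) * K x y * (z y * a k (f y)))"
      by (intro sum_nonneg psd_onD[OF C(2)])
    also have "\<dots> = (\<Sum>x\<in>C. \<Sum>y\<in>C. \<Sum>k<m. (z x * a k (f x)) * K x y * (z y * a k (f y)))"
      by (subst sum.swap, intro sum.cong refl, rule sum.swap)
    also have "\<dots> = (\<Sum>x\<in>C. \<Sum>y\<in>C. z x * (K x y * L (f x) (f y)) * z y)"
    proof (intro sum.cong refl)
      fix x y assume "x \<in> C" "y \<in> C"
      then have "L (f x) (f y) = (\<Sum>k<m. a k (f x) * a k (f y))" using a f by blast
      then show "(\<Sum>k<m. (z x * a k (f x)) * K x y * (z y * a k (f y)))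
          = z x * (K x y * L (f x) (f y)) * z y"
        by (simp add: sum_distrib_left sum_distrib_right mult_ac)
    qed
    finally show ?thesis .
  qed
  moreover have "L (f x) (f y) = L (f y) (f x)" if "x \<in> C" "y \<in> C" for x y
    using V(2) f that unfolding psd_on_def by blast
  ultimately show ?thesis
    using C(2) unfolding psd_on_def by metis
qed

text \<open>Telescoping over the coordinates: the new difference is
  \<open>(?P - ?p) * M j + ?p * (M j - m j)\<close>, and Schur's theorem covers both summands.
  Constant lower bounds for the factors thus give one for the tensor product, on any finite set of
  tuples.\<close>

lemma psd_on_prod_diff:
  assumes "finite C" "finite V" "finite I" and C: "\<And>x i. x \<in> C \<Longrightarrow> i \<in> I \<Longrightarrow> x i \<in> V"
    and M: "\<And>i. i \<in> I \<Longrightarrow> psd_on V (\<lambda>u v. M i u v - m i)" "\<And>i. i \<in> I \<Longrightarrow> 0 \<le> m i"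
  shows "psd_on C (\<lambda>x y. (\<Prod>i\<in>I. M i (x i) (y i)) - (\<Prod>i\<in>I. m i))"
  using assms(3) C M
proof (induction I rule: finite_induct)
  case empty
  then show ?case using psd_on_const[of 0 C] by simp
next
  case (insert j I)
  let ?P = "\<lambda>x y. (\<Prod>i\<in>I. M i (x i) (y i))" and ?p = "\<Prod>i\<in>I. m i"
  have img: "(\<lambda>x. x j) ` C \<subseteq> V" using insert.prems(1) by auto
  have "psd_on V (\<lambda>u v. (M j u v - m j) + m j)"
    using insert.prems by (intro psd_on_add psd_on_const) auto
  then have "psd_on V (M j)" by simp
  then have "psd_on C (\<lambda>x y. (?P x y - ?p) * M j (x j) (y j))"
    using insert img assms(1,2)
    by (intro psd_on_mult_pullback[where f = "\<lambda>x. x j" and V = V and L = "M j"]) auto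
  moreover have "psd_on C (\<lambda>x y. ?p * (M j (x j) (y j) - m j))"
    using insert.prems img assms(1,2)
    by (intro psd_on_mult_pullback[where f = "\<lambda>x. x j" and V = V and L = "\<lambda>u v. M j u v - m j"]
        psd_on_const prod_nonneg) auto
  ultimately have "psd_on C (\<lambda>x y. (?P x y - ?p) * M j (x j) (y j) + ?p * (M j (x j) (y j) - m j))"
    by (rule psd_on_add)
  moreover have "(?P x y - ?p) * M j (x j) (y j) + ?p * (M j (x j) (y j) - m j)
      = (\<Prod>i\<in>insert j I. M i (x i) (y i)) - (\<Prod>i\<in>insert j I. m i)" for x y
    using insert.hyps by (simp add: algebra_simps)
  ultimately show ?case by simp
qed

section \<open>Symmetric functions of characters\<close>

lemma sum_Pow_split:
  fixes f :: "'a set \<Rightarrow> real"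
  assumes "finite A" "i \<in> A"
  shows "sum f (Pow A) = (\<Sum>S\<in>Pow (A - {i}). f S + f (insert i S))"
proof -
  have "Pow A = Pow (insert i (A - {i}))" using assms by (simp add: insert_absorb)
  also have "\<dots> = Pow (A - {i}) \<union> insert i ` Pow (A - {i})" by (rule Pow_insert)
  finally have "sum f (Pow A) = sum f (Pow (A - {i})) + sum f (insert i ` Pow (A - {i}))"
    using assms by (simp only:) (rule sum.union_disjoint; auto)
  also have "sum f (insert i ` Pow (A - {i})) = (\<Sum>S\<in>Pow (A - {i}). f (insert i S))"
    by (subst sum.reindex) (auto simp: inj_on_def insert_eq_iff dest!: PowD)
  finally show ?thesis by (simp add: sum.distrib)
qed

lemma sum_Pow_power_card:
  fixes z :: real
  assumes "finite A"
  shows "(\<Sum>S\<in>Pow A. z ^ card S) = (1 + z) ^ card A"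
  using assms
proof (induction A rule: finite_induct)
  case (insert i A)
  have "(\<Sum>S\<in>Pow (insert i A). z ^ card S) = (\<Sum>S\<in>Pow A. z ^ card S + z ^ card (insert i S))"
    using insert.hyps by (subst sum_Pow_split[of _ i]) auto
  also have "\<dots> = (\<Sum>S\<in>Pow A. (1 + z) * z ^ card S)"
  proof (intro sum.cong refl)
    fix S assume "S \<in> Pow A"
    then have "finite S" "i \<notin> S" using insert.hyps by (auto intro: finite_subset)
    then show "z ^ card S + z ^ card (insert i S) = (1 + z) * z ^ card S"
      by (simp add: algebra_simps)
  qed
  finally show ?case using insert by (simp add: sum_distrib_left[symmetric])
qed simp

text \<open>Chernoff's method: every term of the sum may be multiplied by \<open>r ^ card S / r ^ t \<ge> 1\<close>.\<close>

lemma sum_Pow_tail_le: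
  fixes z r :: real
  assumes "finite A" "0 \<le> z" "0 < r" "r \<le> 1"
  shows "(\<Sum>S | S \<subseteq> A \<and> card S \<le> t. z ^ card S) \<le> (1 + z * r) ^ card A / r ^ t"
proof -
  have "(\<Sum>S | S \<subseteq> A \<and> card S \<le> t. z ^ card S)
      \<le> (\<Sum>S | S \<subseteq> A \<and> card S \<le> t. (z * r) ^ card S / r ^ t)"
  proof (intro sum_mono)
    fix S assume "S \<in> {S. S \<subseteq> A \<and> card S \<le> t}"
    then have "r ^ t \<le> r ^ card S" using assms by (intro power_decreasing) auto
    then have "z ^ card S * r ^ t \<le> z ^ card S * r ^ card S"
      using assms by (intro mult_left_mono) auto
    then show "z ^ card S \<le> (z * r) ^ card S / r ^ t"
      using assms by (simp add: field_simps power_mult_distrib)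
  qed
  also have "\<dots> \<le> (\<Sum>S\<in>Pow A. (z * r) ^ card S / r ^ t)"
    using assms by (intro sum_mono2) auto
  also have "\<dots> = (1 + z * r) ^ card A / r ^ t"
    using assms by (simp add: sum_divide_distrib[symmetric] sum_Pow_power_card)
  finally show ?thesis .
qed

text \<open>
  Multiplication by the sum of the \<open>p i\<close> acts on symmetric functions of the \<open>p i\<close> as a Jacobi
  matrix; this is the three-term recurrence of the Krawtchouk polynomials.
\<close>

lemma symmetric_sum_recurrence:
  fixes p :: "'i \<Rightarrow> real" and \<gamma> :: "nat \<Rightarrow> real"
  assumes A: "finite A" "n = card A"
    and p: "\<And>i. i \<in> A \<Longrightarrow> p i * p i = (q - 2) * p i + (q - 1)"
  shows "(\<Sum>i\<in>A. p i) * (\<Sum>S\<in>Pow A. \<gamma> (card S) * prod p S)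
    = (\<Sum>S\<in>Pow A. (real (card S) * (\<gamma> (card S - 1) + (q - 2) * \<gamma> (card S))
        + (q - 1) * (real n - real (card S)) * \<gamma> (card S + 1)) * prod p S)"
proof -
  define a where "a S = \<gamma> (card S - 1) + (q - 2) * \<gamma> (card S)" for S :: "'i set"
  define c where "c S = (q - 1) * \<gamma> (card S + 1)" for S :: "'i set"
  \<comment> \<open>If \<open>i\<close> lies in \<open>S\<close>, then \<open>prod p S\<close>
    arises from \<open>S - {i}\<close> and, through the linear part of \<open>p i * p i\<close>,
    from \<open>S\<close> itself; otherwise it arises from \<open>insert i S\<close> through the
    constant part. The value \<open>a S\<close> counts only for nonempty \<open>S\<close>, so the
    truncated \<open>card S - 1\<close> is harmless.\<close>
  have step: "p i * (\<Sum>S\<in>Pow A. \<gamma> (card S) * prod p S)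
      = (\<Sum>S\<in>Pow A. (if i \<in> S then a S else c S) * prod p S)" if i: "i \<in> A" for i
  proof -
    have "p i * (\<Sum>S\<in>Pow A. \<gamma> (card S) * prod p S)
        = (\<Sum>S\<in>Pow (A - {i}). p i * (\<gamma> (card S) * prod p S)
            + p i * (\<gamma> (card (insert i S)) * prod p (insert i S)))"
      by (subst sum_Pow_split[OF A(1) i]) (simp add: sum_distrib_left algebra_simps)
    also have "\<dots> = (\<Sum>S\<in>Pow (A - {i}). (if i \<in> S then a S else c S) * prod p S
        + (if i \<in> insert i S then a (insert i S) else c (insert i S)) * prod p (insert i S))"
    proof (intro sum.cong refl)
      fix S assume "S \<in> Pow (A - {i})"
      then have S: "finite S" "i \<notin> S" using A by (auto intro: finite_subset)
      have "p i * (\<gamma> (card S) * prod p S) + p i * (\<gamma> (card (insert i S)) * prod p (insert i S))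
          = \<gamma> (card S) * (p i * prod p S) + \<gamma> (card S + 1) * (p i * p i) * prod p S"
        using S by (simp add: algebra_simps)
      also have "\<dots> = \<gamma> (card S) * (p i * prod p S)
          + \<gamma> (card S + 1) * ((q - 2) * p i + (q - 1)) * prod p S"
        by (simp only: p[OF i])
      finally show "p i * (\<gamma> (card S) * prod p S) + p i * (\<gamma> (card (insert i S)) * prod p (insert i S))
          = (if i \<in> S then a S else c S) * prod p S
            + (if i \<in> insert i S then a (insert i S) else c (insert i S)) * prod p (insert i S)"
        using S by (simp add: a_def c_def algebra_simps)
    qed
    also have "\<dots> = (\<Sum>S\<in>Pow A. (if i \<in> S then a S else c S) * prod p S)"
      by (rule sum_Pow_split[OF A(1) i, symmetric])
    finally show ?thesis .
  qed
  have "(\<Sum>i\<in>A. p i) * (\<Sum>S\<in>Pow A. \<gamma> (card S) * prod p S)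
      = (\<Sum>i\<in>A. \<Sum>S\<in>Pow A. (if i \<in> S then a S else c S) * prod p S)"
    by (subst sum_distrib_right) (intro sum.cong refl step)
  also have "\<dots> = (\<Sum>S\<in>Pow A. \<Sum>i\<in>A. (if i \<in> S then a S else c S) * prod p S)"
    by (rule sum.swap)
  also have "\<dots> = (\<Sum>S\<in>Pow A. (real (card S) * a S + (real n - real (card S)) * c S) * prod p S)"
  proof (intro sum.cong refl)
    fix S assume S: "S \<in> Pow A"
    then have "(\<Sum>i\<in>A. if i \<in> S then a S else c S) = (\<Sum>i\<in>S. a S) + (\<Sum>i\<in>A - S. c S)"
      using A by (subst sum.If_cases) (auto simp: Int_absorb1 Int_Diff Diff_eq)
    also have "\<dots> = real (card S) * a S + (real n - real (card S)) * c S"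
      using S A by (simp add: card_Diff_subset finite_subset[of S A] of_nat_diff card_mono)
    finally show "(\<Sum>i\<in>A. (if i \<in> S then a S else c S) * prod p S)
        = (real (card S) * a S + (real n - real (card S)) * c S) * prod p S"
      by (simp add: sum_distrib_right[symmetric])
  qed
  finally show ?thesis
    by (simp add: a_def c_def algebra_simps)
qed

section \<open>The linear programming bound\<close>

text \<open>
  \<open>E\<close> plays the role of the all-ones matrix of the \<open>q\<close>-ary Hamming scheme with a single coordinate, and
  \<open>\<phi>\<close> that of the nontrivial zonal function: on the pairs where \<open>E\<close> does not vanish, \<open>\<phi> * E\<close>
  is \<open>(q - 1) * I - B\<close>.
\<close>

locale scheme_kernel =
  fixes V :: "'a set" and B :: "'a \<Rightarrow> 'a \<Rightarrow> real" and q \<theta> :: real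
  assumes fin: "finite V"
    and q: "2 \<le> q" and \<theta>: "0 < \<theta>"
    and B_nonneg: "\<And>u v. 0 \<le> B u v"
    and psd_theta: "psd_on V (\<lambda>u v. (if u = v then 1 else B u v) - 1 / \<theta>)"
    and psd_degree: "psd_on V (\<lambda>u v. if u = v then q - 1 else - B u v)"
begin

definition E :: "'a \<Rightarrow> 'a \<Rightarrow> real" where
  "E u v = (if u = v then 1 else B u v)"

definition \<phi> :: "'a \<Rightarrow> 'a \<Rightarrow> real" where
  "\<phi> u v = (if u = v then q - 1 else - 1)"

text \<open>The two values \<open>q - 1\<close> and \<open>-1\<close> are the roots of
  \<open>X^2 - (q - 2) X - (q - 1)\<close>. This is the relation that
  \<open>symmetric_sum_recurrence\<close> asks for.\<close>

lemma phi_square: "\<phi> u v * \<phi> u v = (q - 2) * \<phi> u v + (q - 1)"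
  by (simp add: \<phi>_def algebra_simps)

lemma psd_E: "psd_on V (\<lambda>u v. E u v - 1 / \<theta>)"
  using psd_theta by (simp add: E_def)

lemma psd_phi_E: "psd_on V (\<lambda>u v. \<phi> u v * E u v)"
  by (rule iffD1[OF psd_on_cong psd_degree]) (simp add: E_def \<phi>_def)

text \<open>By \<open>phi_square\<close> this is a combination of the two preceding kernels with
  coefficients \<open>q - 2\<close> and \<open>q - 1\<close>, nonnegative because
  \<open>2 \<le> q\<close>.\<close>

lemma psd_phi_phi_E: "psd_on V (\<lambda>u v. \<phi> u v * \<phi> u v * E u v - (q - 1) / \<theta>)"
proof -
  have "psd_on V (\<lambda>u v. (q - 2) * (\<phi> u v * E u v) + (q - 1) * (E u v - 1 / \<theta>))"
    using q by (intro psd_on_add psd_on_scale psd_phi_E psd_E) auto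
  then show ?thesis
    by (simp add: phi_square algebra_simps)
qed

text \<open>If \<open>V\<close> were an abelian group of order \<open>q\<close>, this would be the
  sum of the group characters with support exactly \<open>S\<close>, evaluated at the difference of
  \<open>x\<close> and \<open>y\<close>.\<close>

definition character :: "nat set \<Rightarrow> (nat \<Rightarrow> 'a) \<Rightarrow> (nat \<Rightarrow> 'a) \<Rightarrow> real" where
  "character S x y = (\<Prod>i\<in>S. \<phi> (x i) (y i))"

definition weight :: "nat \<Rightarrow> (nat \<Rightarrow> 'a) \<Rightarrow> (nat \<Rightarrow> 'a) \<Rightarrow> real" where
  "weight n x y = (\<Prod>i<n. E (x i) (y i))"

text \<open>One-sided orthogonality of characters. A coordinate in both sets contributes
  \<open>\<phi> * \<phi> * E\<close> with lower bound \<open>(q - 1) / \<theta>\<close>, one in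
  exactly one set \<open>\<phi> * E\<close> with bound \<open>0\<close>, one in neither
  \<open>E\<close> with bound \<open>1 / \<theta>\<close>. The product of the bounds vanishes unless
  \<open>S = T\<close>.\<close>

lemma psd_character_product:
  assumes "finite C" and C: "\<And>x i. x \<in> C \<Longrightarrow> i < n \<Longrightarrow> x i \<in> V"
    and S: "S \<subseteq> {..<n}" "T \<subseteq> {..<n}"
  shows "psd_on C (\<lambda>x y. character S x y * character T x y * weight n x y
    - (if S = T then (q - 1) ^ card S / \<theta> ^ n else 0))"
proof -
  define M where "M i u v = (if i \<in> S then \<phi> u v else 1) * (if i \<in> T then \<phi> u v else 1) * E u v"
    for i u v
  define m where "m i = (if i \<in> S \<and> i \<in> T then (q - 1) / \<theta> else if i \<in> S \<or> i \<in> T then 0 else 1 / \<theta>)"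
    for i
  have "psd_on C (\<lambda>x y. (\<Prod>i<n. M i (x i) (y i)) - (\<Prod>i<n. m i))"
  proof (rule psd_on_prod_diff[OF assms(1) fin])
    fix i assume "i \<in> {..<n}"
    show "psd_on V (\<lambda>u v. M i u v - m i)"
      using psd_E psd_phi_E psd_phi_phi_E
      by (cases "i \<in> S"; cases "i \<in> T") (simp_all add: M_def m_def)
    show "0 \<le> m i" using q \<theta> by (simp add: m_def)
  qed (use C in auto)
  moreover have "(\<Prod>i<n. M i (x i) (y i)) = character S x y * character T x y * weight n x y" for x y
    using S by (simp add: M_def prod.distrib character_def weight_def prod.If_cases Int_absorb1)
  moreover have "(\<Prod>i<n. m i) = (if S = T then (q - 1) ^ card S / \<theta> ^ n else 0)"
  proof (cases "S = T")
    case True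
    have "(\<Prod>i<n. m i) = (\<Prod>i<n. (if i \<in> S then q - 1 else 1) * (1 / \<theta>))"
      using True by (intro prod.cong) (auto simp: m_def)
    also have "\<dots> = (q - 1) ^ card S / \<theta> ^ n"
      using S by (simp only: prod.distrib) (simp add: prod.If_cases Int_absorb1 power_one_over)
    finally show ?thesis using True by simp
  next
    case False
    then obtain i where "i < n" "m i = 0"
    proof -
      from False obtain i where "i \<in> S - T \<or> i \<in> T - S" by blast
      with S that[of i] show ?thesis by (auto simp: m_def)
    qed
    with False show ?thesis by (auto intro!: prod_zero)
  qed
  ultimately show ?thesis by simp
qed

lemma sum_character_product_ge:
  assumes "finite C" "\<And>x i. x \<in> C \<Longrightarrow> i < n \<Longrightarrow> x i \<in> V" "S \<subseteq> {..<n}" "T \<subseteq> {..<n}"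
  shows "(if S = T then (q - 1) ^ card S / \<theta> ^ n * (real (card C))\<^sup>2 else 0)
    \<le> (\<Sum>x\<in>C. \<Sum>y\<in>C. character S x y * character T x y * weight n x y)"
proof -
  let ?m = "if S = T then (q - 1) ^ card S / \<theta> ^ n else 0"
  have "0 \<le> (\<Sum>x\<in>C. \<Sum>y\<in>C. character S x y * character T x y * weight n x y - ?m)"
    using psd_onD[OF psd_character_product[of C n S T], of "\<lambda>_. 1"] assms by simp
  also have "\<dots> = (\<Sum>x\<in>C. \<Sum>y\<in>C. character S x y * character T x y * weight n x y)
      - ?m * (real (card C))\<^sup>2"
    by (simp add: sum_subtractf power2_eq_square)
  finally show ?thesis by (simp split: if_splits)
qed

text \<open>
  The hypothesis \<open>jacobi\<close> says that \<open>(\<Sum>i<n. \<phi> (x i) (y i)) - c\<close> times the symmetric function with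
  coefficients \<open>\<gamma>\<close> has coefficients at least \<open>\<gamma>\<close>.
\<close>

lemma linear_programming_bound:
  fixes \<gamma> :: "nat \<Rightarrow> real"
  assumes C: "finite C" "C \<noteq> {}" "\<And>x i. x \<in> C \<Longrightarrow> i < n \<Longrightarrow> x i \<in> V"
    and sep: "\<And>x y. x \<in> C \<Longrightarrow> y \<in> C \<Longrightarrow> x \<noteq> y \<Longrightarrow>
      (\<exists>i<n. x i \<noteq> y i \<and> B (x i) (y i) = 0) \<or> d \<le> real (card {i. i < n \<and> x i \<noteq> y i})"
    and c: "c = (q - 1) * real n - q * d"
    and \<gamma>: "\<And>s. 0 \<le> \<gamma> s"
    and jacobi: "\<And>s. s \<le> n \<Longrightarrow> (c + 1) * \<gamma> s \<le>
      real s * (\<gamma> (s - 1) + (q - 2) * \<gamma> s) + (q - 1) * (real n - real s) * \<gamma> (s + 1)"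
  shows "real (card C) * (\<Sum>S\<in>Pow {..<n}. (\<gamma> (card S))\<^sup>2 * (q - 1) ^ card S)
    \<le> \<theta> ^ n * (q * d) * (\<Sum>S\<in>Pow {..<n}. \<gamma> (card S) * (q - 1) ^ card S)\<^sup>2"
proof -
  let ?A = "{..<n}"
  \<comment> \<open>The coefficients of \<open>((\<Sum>i<n. \<phi> (x i) (y i)) - c) * g\<close>, by
    the recurrence.\<close>
  define h where "h s = real s * (\<gamma> (s - 1) + (q - 2) * \<gamma> s)
    + (q - 1) * (real n - real s) * \<gamma> (s + 1) - c * \<gamma> s" for s
  define g where "g x y = (\<Sum>S\<in>Pow ?A. \<gamma> (card S) * character S x y)" for x y
  \<comment> \<open>The sum of \<open>F\<close> over \<open>C \<times> C\<close> is bounded below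
    through its expansion in characters and above through its diagonal.\<close>
  define F where "F x y = ((\<Sum>i<n. \<phi> (x i) (y i)) - c) * g x y * g x y * weight n x y" for x y
  have card_le: "card S \<le> n" if "S \<subseteq> ?A" for S
    using card_mono[OF _ that] by simp
  have h: "\<gamma> (card S) \<le> h (card S)" if "S \<subseteq> ?A" for S
    using jacobi[OF card_le[OF that]] by (simp add: h_def algebra_simps)
  have expand: "F x y = (\<Sum>S\<in>Pow ?A. \<Sum>T\<in>Pow ?A.
      h (card S) * \<gamma> (card T) * (character S x y * character T x y * weight n x y))" for x y
  proof -
    have "(\<Sum>i<n. \<phi> (x i) (y i)) * g x y = (\<Sum>S\<in>Pow ?A. (h (card S) + c * \<gamma> (card S)) * character S x y)"
      unfolding g_def character_def h_def
      by (subst symmetric_sum_recurrence[of ?A n]) (auto simp: phi_square)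
    also have "\<dots> = (\<Sum>S\<in>Pow ?A. h (card S) * character S x y) + c * g x y"
      by (simp only: distrib_right sum.distrib g_def sum_distrib_left mult.assoc)
    finally have "((\<Sum>i<n. \<phi> (x i) (y i)) - c) * g x y = (\<Sum>S\<in>Pow ?A. h (card S) * character S x y)"
      by (simp add: left_diff_distrib)
    then have "F x y = (\<Sum>S\<in>Pow ?A. h (card S) * character S x y) * g x y * weight n x y"
      by (simp add: F_def)
    also have "\<dots> = (\<Sum>S\<in>Pow ?A. \<Sum>T\<in>Pow ?A.
        (h (card S) * character S x y) * (\<gamma> (card T) * character T x y) * weight n x y)"
      by (simp only: g_def sum_product) (simp only: sum_distrib_right)
    finally show ?thesis
      by (simp only: mult_ac)
  qed
  have "(\<Sum>S\<in>Pow ?A. (\<gamma> (card S))\<^sup>2 * (q - 1) ^ card S) * (real (card C))\<^sup>2 / \<theta> ^ n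
      \<le> (\<Sum>S\<in>Pow ?A. \<Sum>T\<in>Pow ?A. h (card S) * \<gamma> (card T) *
          (if S = T then (q - 1) ^ card S / \<theta> ^ n * (real (card C))\<^sup>2 else 0))"
  proof -
    have "(\<gamma> (card S))\<^sup>2 * (q - 1) ^ card S * (real (card C))\<^sup>2 / \<theta> ^ n
        \<le> h (card S) * \<gamma> (card S) * ((q - 1) ^ card S / \<theta> ^ n * (real (card C))\<^sup>2)"
      if "S \<subseteq> ?A" for S
    proof -
      have "\<gamma> (card S) * \<gamma> (card S) * ((q - 1) ^ card S / \<theta> ^ n * (real (card C))\<^sup>2)
          \<le> h (card S) * \<gamma> (card S) * ((q - 1) ^ card S / \<theta> ^ n * (real (card C))\<^sup>2)"
        using h[OF that] q \<theta> \<gamma> by (intro mult_right_mono) auto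
      then show ?thesis by (simp add: power2_eq_square mult_ac)
    qed
    then show ?thesis
      by (simp add: sum_distrib_right sum_divide_distrib if_distrib[of "(*) _"] cong: if_cong)
        (intro sum_mono, auto)
  qed
  \<comment> \<open>The coefficients \<open>h (card S) * \<gamma> (card T)\<close> are nonnegative,
    so orthogonality may be applied term by term.\<close>
  also have "\<dots> \<le> (\<Sum>S\<in>Pow ?A. \<Sum>T\<in>Pow ?A. h (card S) * \<gamma> (card T) *
      (\<Sum>x\<in>C. \<Sum>y\<in>C. character S x y * character T x y * weight n x y))"
  proof (intro sum_mono mult_left_mono sum_character_product_ge)
    fix S assume "S \<in> Pow ?A"
    then have "0 \<le> h (card S)" using h \<gamma> order_trans by blast
    then show "0 \<le> h (card S) * \<gamma> (card T)" for T using \<gamma> by simp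
  qed (use C in auto)
  also have "\<dots> = (\<Sum>x\<in>C. \<Sum>y\<in>C. F x y)"
  proof -
    have "(\<Sum>S\<in>Pow ?A. \<Sum>T\<in>Pow ?A. \<Sum>x\<in>C. \<Sum>y\<in>C. f S T x y)
        = (\<Sum>x\<in>C. \<Sum>y\<in>C. \<Sum>S\<in>Pow ?A. \<Sum>T\<in>Pow ?A. f S T x y)"
      for f :: "nat set \<Rightarrow> nat set \<Rightarrow> (nat \<Rightarrow> 'a) \<Rightarrow> (nat \<Rightarrow> 'a) \<Rightarrow> real"
      unfolding sum.swap[where A = "Pow ?A" and B = C] ..
    then show ?thesis
      unfolding expand by (simp add: sum_distrib_left)
  qed
  \<comment> \<open>Off the diagonal either the weight vanishes, or the Hamming distance is at least
    \<open>d\<close>; in the second case the sum of the \<open>\<phi>\<close>, being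
    \<open>(q - 1) * n\<close> minus \<open>q\<close> times the distance, is at most
    \<open>c\<close>.\<close>
  also have "\<dots> \<le> (\<Sum>x\<in>C. F x x)"
  proof (intro sum_mono)
    fix x assume x: "x \<in> C"
    have "F x y \<le> 0" if y: "y \<in> C" "y \<noteq> x" for y
    proof (cases "weight n x y = 0")
      case False
      have w: "0 \<le> weight n x y"
        using B_nonneg by (auto simp: weight_def E_def intro!: prod_nonneg)
      have "E (x i) (y i) \<noteq> 0" if "i < n" for i
        using False that by (auto simp: weight_def)
      with sep[OF x y(1)] y(2) have d: "d \<le> real (card {i. i < n \<and> x i \<noteq> y i})"
        by (metis E_def)
      have "(\<Sum>i<n. \<phi> (x i) (y i)) = (\<Sum>i<n. (q - 1) - q * (if x i \<noteq> y i then 1 else 0))"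
        by (intro sum.cong) (auto simp: \<phi>_def)
      also have "\<dots> = (q - 1) * real n - q * real (card {i. i < n \<and> x i \<noteq> y i})"
        by (simp add: sum_subtractf sum_distrib_left[symmetric] sum.If_cases lessThan_def Collect_conj_eq[symmetric] conj_commute)
      also have "\<dots> \<le> c" using d q unfolding c by simp
      finally have "((\<Sum>i<n. \<phi> (x i) (y i)) - c) * (g x y * g x y * weight n x y) \<le> 0"
        using w by (intro mult_nonpos_nonneg) auto
      then show ?thesis by (simp add: F_def mult_ac)
    qed (simp add: F_def)
    then have "(\<Sum>y\<in>C - {x}. F x y) \<le> 0" by (intro sum_nonpos) auto
    then show "(\<Sum>y\<in>C. F x y) \<le> F x x" using sum.remove[OF C(1) x, of "F x"] by simp
  qed
  \<comment> \<open>On the diagonal the weight is \<open>1\<close>, the characters are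
    \<open>(q - 1) ^ card S\<close>, and the linear factor is
    \<open>(q - 1) * n - c = q * d\<close>.\<close>
  also have "\<dots> = real (card C) * (q * d * (\<Sum>S\<in>Pow ?A. \<gamma> (card S) * (q - 1) ^ card S)\<^sup>2)"
    by (simp add: F_def g_def character_def weight_def \<phi>_def E_def c power2_eq_square algebra_simps)
  finally have "real (card C) * ((\<Sum>S\<in>Pow ?A. (\<gamma> (card S))\<^sup>2 * (q - 1) ^ card S) * real (card C) / \<theta> ^ n)
      \<le> real (card C) * (q * d * (\<Sum>S\<in>Pow ?A. \<gamma> (card S) * (q - 1) ^ card S)\<^sup>2)"
    by (simp add: power2_eq_square mult_ac)
  moreover have "0 < real (card C)" using C by (simp add: card_gt_0_iff)
  ultimately show ?thesis
    using \<theta> by (simp add: field_simps)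
qed

text \<open>By Cauchy--Schwarz, only the size of the support of \<open>\<gamma>\<close> matters.\<close>

lemma linear_programming_bound_support:
  fixes \<gamma> :: "nat \<Rightarrow> real"
  assumes C: "finite C" "C \<noteq> {}" "\<And>x i. x \<in> C \<Longrightarrow> i < n \<Longrightarrow> x i \<in> V"
    and sep: "\<And>x y. x \<in> C \<Longrightarrow> y \<in> C \<Longrightarrow> x \<noteq> y \<Longrightarrow>
      (\<exists>i<n. x i \<noteq> y i \<and> B (x i) (y i) = 0) \<or> d \<le> real (card {i. i < n \<and> x i \<noteq> y i})"
    and d: "0 \<le> d"
    and \<gamma>: "\<And>s. 0 \<le> \<gamma> s" "\<And>s. t < s \<Longrightarrow> \<gamma> s = 0" and pos: "s0 \<le> n" "0 < \<gamma> s0"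
    and jacobi: "\<And>s. s \<le> n \<Longrightarrow> ((q - 1) * real n - q * d + 1) * \<gamma> s \<le>
      real s * (\<gamma> (s - 1) + (q - 2) * \<gamma> s) + (q - 1) * (real n - real s) * \<gamma> (s + 1)"
  shows "real (card C) \<le> \<theta> ^ n * (q * d) * (\<Sum>S | S \<subseteq> {..<n} \<and> card S \<le> t. (q - 1) ^ card S)"
proof -
  let ?A = "{..<n}" and ?P = "{S. S \<subseteq> {..<n} \<and> card S \<le> t}"
  let ?Z = "\<Sum>S\<in>Pow ?A. (\<gamma> (card S))\<^sup>2 * (q - 1) ^ card S"
  have "(\<Sum>S\<in>Pow ?A. \<gamma> (card S) * (q - 1) ^ card S)\<^sup>2 = (\<Sum>S\<in>?P. \<gamma> (card S) * (q - 1) ^ card S)\<^sup>2"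
    using \<gamma>(2) by (intro arg_cong[of _ _ "\<lambda>x. x\<^sup>2"] sum.mono_neutral_right) (auto simp: not_le)
  also have "\<dots> = (\<Sum>S\<in>?P. (\<gamma> (card S) * sqrt ((q - 1) ^ card S)) * sqrt ((q - 1) ^ card S))\<^sup>2"
    using q by (simp add: mult.assoc)
  also have "\<dots> \<le> (\<Sum>S\<in>?P. (\<gamma> (card S) * sqrt ((q - 1) ^ card S))\<^sup>2) * (\<Sum>S\<in>?P. (sqrt ((q - 1) ^ card S))\<^sup>2)"
    by (rule Cauchy_Schwarz_ineq_sum)
  also have "\<dots> = (\<Sum>S\<in>?P. (\<gamma> (card S))\<^sup>2 * (q - 1) ^ card S) * (\<Sum>S\<in>?P. (q - 1) ^ card S)"
    using q by (simp add: power_mult_distrib)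
  also have "(\<Sum>S\<in>?P. (\<gamma> (card S))\<^sup>2 * (q - 1) ^ card S) = ?Z"
    using \<gamma>(2) by (intro sum.mono_neutral_left) (auto simp: not_le)
  finally have cs: "(\<Sum>S\<in>Pow ?A. \<gamma> (card S) * (q - 1) ^ card S)\<^sup>2 \<le> ?Z * (\<Sum>S\<in>?P. (q - 1) ^ card S)" .
  have "0 < ?Z"
  proof (rule sum_pos2[where i = "{..<s0}"])
    show "0 < (\<gamma> (card {..<s0}))\<^sup>2 * (q - 1) ^ card {..<s0}" using pos q by simp
  qed (use pos q in auto)
  have "real (card C) * ?Z \<le> \<theta> ^ n * (q * d) * (\<Sum>S\<in>Pow ?A. \<gamma> (card S) * (q - 1) ^ card S)\<^sup>2"
    using C sep refl \<gamma>(1) jacobi by (rule linear_programming_bound)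
  also have "\<dots> \<le> \<theta> ^ n * (q * d) * (?Z * (\<Sum>S\<in>?P. (q - 1) ^ card S))"
    using cs \<theta> q d by (intro mult_left_mono) auto
  finally have "real (card C) * ?Z \<le> (\<theta> ^ n * (q * d) * (\<Sum>S\<in>?P. (q - 1) ^ card S)) * ?Z"
    by (simp add: mult_ac)
  with \<open>0 < ?Z\<close> show ?thesis by simp
qed

end

text \<open>
  Near level \<open>\<tau> n\<close> the Jacobi matrix of the Krawtchouk recurrence is, after the rescaling by \<open>\<rho> ^ s\<close>,
  almost a tridiagonal Toeplitz matrix. The approximate eigenvector is the parabola \<open>v\<close> supported on
  a window of constant length \<open>m\<close>.
\<close>

lemma eventually_jacobi_vector:
  fixes q \<tau> \<kappa> :: real
  assumes q: "2 \<le> q" and \<tau>: "0 < \<tau>" "\<tau> < 1"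
    and \<kappa>: "\<kappa> < (q - 2) * \<tau> + 2 * sqrt ((q - 1) * \<tau> * (1 - \<tau>))"
  shows "\<forall>\<^sub>F n in sequentially. \<exists>\<gamma>. (\<forall>s. 0 \<le> \<gamma> s) \<and> (\<forall>s. nat \<lfloor>\<tau> * real n\<rfloor> < s \<longrightarrow> \<gamma> s = 0) \<and>
    (\<exists>s\<le>n. 0 < \<gamma> s) \<and>
    (\<forall>s\<le>n. (\<kappa> * real n + 1) * \<gamma> s \<le>
      real s * (\<gamma> (s - 1) + (q - 2) * \<gamma> s) + (q - 1) * (real n - real s) * \<gamma> (s + 1))"
proof -
  \<comment> \<open>At level \<open>\<tau> n\<close> the off-diagonal entries of the recurrence are,
    per unit of \<open>n\<close>, \<open>\<tau>\<close> and \<open>(q - 1) * (1 - \<tau>)\<close>.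
    Their geometric mean is \<open>a\<close>, and rescaling by \<open>\<rho>\<close> makes both
    equal to \<open>a\<close>. The slack in the hypothesis on \<open>\<kappa>\<close> is
    \<open>\<eta>\<close>.\<close>
  define a where "a = sqrt ((q - 1) * \<tau> * (1 - \<tau>))"
  define \<rho> where "\<rho> = \<tau> / a"
  define \<eta> where "\<eta> = (q - 2) * \<tau> + 2 * a - \<kappa>"
  have a: "0 < a" "a * a = (q - 1) * \<tau> * (1 - \<tau>)"
    using q \<tau> by (simp_all add: a_def)
  have \<rho>: "0 < \<rho>" "\<tau> / \<rho> = a" using a \<tau> by (simp_all add: \<rho>_def)
  have \<rho>2: "(q - 1) * (1 - \<tau>) * \<rho> = a"
    using a \<tau> by (simp add: \<rho>_def field_simps)
  have \<eta>: "0 < \<eta>" using \<kappa> by (simp add: \<eta>_def a_def)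
  \<comment> \<open>A finite window replaces the factor \<open>2\<close> of \<open>a\<close> by
    \<open>2 - 2 / m\<close>; for this \<open>m\<close> the loss \<open>2 * a / m\<close> is below
    \<open>\<eta> / 2\<close>.\<close>
  obtain m :: nat where m: "4 * a / \<eta> < real m" using reals_Archimedean2 by blast
  have m0: "0 < real m" using m a \<eta> by (meson divide_pos_pos less_trans mult_pos_pos zero_less_numeral)
  have slope: "2 * a / real m < \<eta> / 2" using m m0 \<eta> by (simp add: field_simps)
  \<comment> \<open>A common lower bound for both rescaled off-diagonal entries throughout the
    window.\<close>
  define L where "L n = a * real n - real m / \<rho>" for n :: nat
  \<comment> \<open>The three thresholds keep the window above level \<open>0\<close>, make
    \<open>L n\<close> nonnegative, and fit the bounded errors into
    \<open>\<eta> / 2 * n\<close>.\<close>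
  have "\<forall>\<^sub>F n in sequentially. max (max ((real m + 1) / \<tau>) (real m / \<rho> / a))
      ((2 * real m / \<rho> + (q - 2) * real m + 1) * 2 / \<eta>) \<le> real n"
    by (rule eventually_compose_filterlim[OF eventually_ge_at_top filterlim_real_sequentially])
  then show ?thesis
  proof (rule eventually_mono)
    fix n :: nat
    assume "max (max ((real m + 1) / \<tau>) (real m / \<rho> / a))
      ((2 * real m / \<rho> + (q - 2) * real m + 1) * 2 / \<eta>) \<le> real n"
    then have "(real m + 1) / \<tau> \<le> real n" "real m / \<rho> / a \<le> real n"
      "(2 * real m / \<rho> + (q - 2) * real m + 1) * 2 / \<eta> \<le> real n"
      by simp_all
    then have n1: "real m + 1 \<le> \<tau> * real n" and L0: "0 \<le> L n"
      and n3: "2 * real m / \<rho> + (q - 2) * real m + 1 \<le> \<eta> / 2 * real n"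
      using \<tau> \<eta> a(1) pos_divide_le_eq[OF a(1), of "real m / \<rho>" "real n"]
      by (simp_all add: L_def field_simps del: divide_divide_eq_left)
    define t where "t = nat \<lfloor>\<tau> * real n\<rfloor>"
    have n0: "0 \<le> \<tau> * real n" using \<tau> by simp
    have t: "real t \<le> \<tau> * real n" "\<tau> * real n < real t + 1"
      unfolding t_def using n0 by (simp_all add: of_nat_nat)
    have "real m < real t" using n1 t by linarith
    then have mt: "m < t" by simp
    have "\<tau> * real n \<le> 1 * real n" using \<tau> by (intro mult_right_mono) auto
    then have tn: "t \<le> n" using t by linarith
    \<comment> \<open>The zeros \<open>t - m\<close> and \<open>t + 1\<close> of the parabola are
      the levels just outside the window.\<close>
    define v where "v s = (if t - m < s \<and> s \<le> t then (real s - (real t - real m)) * (real t + 1 - real s) else 0)"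
      for s
    define \<gamma> where "\<gamma> s = v s * \<rho> ^ s" for s
    have v: "0 \<le> v s" for s using mt by (auto simp: v_def intro!: mult_nonneg_nonneg)
    have "(\<kappa> * real n + 1) * \<gamma> s \<le>
      real s * (\<gamma> (s - 1) + (q - 2) * \<gamma> s) + (q - 1) * (real n - real s) * \<gamma> (s + 1)"
      if s: "s \<le> n" for s
    proof (cases "t - m < s \<and> s \<le> t")
      case False
      then have "v s = 0" by (auto simp: v_def)
      then have "\<gamma> s = 0" by (simp add: \<gamma>_def)
      then show ?thesis using q s v \<rho> by (simp add: \<gamma>_def)
    next
      case True
      then have s1: "1 \<le> s" by simp
      define i where "i = real s - (real t - real m)"
      have i: "1 \<le> i" "i \<le> real m" using True mt by (auto simp: i_def)
      have vs: "v s = i * (real m + 1 - i)" using True by (simp add: v_def i_def algebra_simps)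
      \<comment> \<open>The polynomial formula also holds for the neighbours outside the window,
        since it vanishes there.\<close>
      have vl: "v (s - 1) = (i - 1) * (real m + 2 - i)"
      proof (cases "s = t - m + 1")
        case True
        then show ?thesis using mt by (simp add: v_def i_def of_nat_diff)
      next
        case False
        then have "t - m < s - 1 \<and> s - 1 \<le> t" using True by linarith
        then show ?thesis using s1 by (simp add: v_def i_def of_nat_diff algebra_simps)
      qed
      have vr: "v (s + 1) = (i + 1) * (real m - i)"
        using True mt by (cases "s = t") (auto simp: v_def i_def algebra_simps)
      \<comment> \<open>The second difference of \<open>v\<close> is \<open>-2\<close>, while
        \<open>v s\<close> is at least \<open>m\<close> in the window; hence the loss is at most
        \<open>2 / m\<close> times \<open>v s\<close>.\<close>
      have "0 \<le> (i - 1) * (real m - i)" using i by (intro mult_nonneg_nonneg) auto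
      then have "real m \<le> v s" by (simp add: vs algebra_simps)
      then have "2 \<le> 2 / real m * v s" using m0 by (simp add: field_simps)
      moreover have "v (s - 1) + v (s + 1) = 2 * v s - 2"
        unfolding vs vl vr by (simp add: algebra_simps)
      ultimately have neighbours: "(2 - 2 / real m) * v s \<le> v (s - 1) + v (s + 1)"
        by (simp add: algebra_simps)
      have sl: "\<tau> * real n - real m \<le> real s" using i t by (simp add: i_def)
      have "(\<tau> * real n - real m) / \<rho> \<le> real s / \<rho>" using sl \<rho> by (intro divide_right_mono) auto
      moreover have "(\<tau> * real n - real m) / \<rho> = L n"
        using \<rho> by (simp add: L_def diff_divide_distrib flip: \<rho>(2))
      ultimately have cl: "L n \<le> real s / \<rho>" by simp
      have "real s \<le> \<tau> * real n" using True t by linarith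
      then have "(1 - \<tau>) * real n \<le> real n - real s" by (simp add: algebra_simps)
      then have "((q - 1) * \<rho>) * ((1 - \<tau>) * real n) \<le> ((q - 1) * \<rho>) * (real n - real s)"
        using q \<rho> by (intro mult_left_mono) auto
      moreover have "((q - 1) * \<rho>) * ((1 - \<tau>) * real n) = a * real n"
        by (simp flip: \<rho>2)
      moreover have "L n \<le> a * real n" using \<rho> by (simp add: L_def)
      ultimately have cr: "L n \<le> (q - 1) * \<rho> * (real n - real s)" by linarith
      \<comment> \<open>Half of the slack \<open>\<eta> * n\<close> pays for the finite window, the
        other half for levels up to \<open>m\<close> below \<open>\<tau> n\<close> and for the
        summand \<open>1\<close>.\<close>
      have "\<kappa> * real n + 1 \<le> L n * (2 - 2 / real m) + (q - 2) * (\<tau> * real n - real m)"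
      proof -
        have "2 * a / real m * real n \<le> \<eta> / 2 * real n" using slope by (intro mult_right_mono) auto
        moreover have "L n * (2 - 2 / real m) = 2 * a * real n - 2 * real m / \<rho> - 2 * a / real m * real n + 2 / \<rho>"
          using m0 by (simp add: L_def field_simps)
        moreover have "0 < 2 / \<rho>" using \<rho> by simp
        moreover have "\<eta> * real n = (q - 2) * \<tau> * real n + 2 * a * real n - \<kappa> * real n"
          by (simp add: \<eta>_def algebra_simps)
        ultimately have "\<kappa> * real n + 1
            \<le> L n * (2 - 2 / real m) + ((q - 2) * \<tau> * real n - (q - 2) * real m)"
          using n3 by linarith
        then show ?thesis by (simp add: algebra_simps)
      qed
      then have "(\<kappa> * real n + 1) * v s \<le> (L n * (2 - 2 / real m) + (q - 2) * (\<tau> * real n - real m)) * v s"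
        using v by (intro mult_right_mono)
      also have "\<dots> = L n * ((2 - 2 / real m) * v s) + (q - 2) * (\<tau> * real n - real m) * v s"
        by (simp add: algebra_simps)
      also have "\<dots> \<le> L n * (v (s - 1) + v (s + 1)) + (q - 2) * real s * v s"
        using neighbours L0 q v sl by (intro add_mono mult_left_mono mult_right_mono) auto
      also have "\<dots> \<le> (real s / \<rho> * v (s - 1) + (q - 1) * \<rho> * (real n - real s) * v (s + 1)) + (q - 2) * real s * v s"
        using mult_right_mono[OF cl v[of "s - 1"]] mult_right_mono[OF cr v[of "s + 1"]]
        by (simp add: algebra_simps)
      \<comment> \<open>Multiplying by \<open>\<rho> ^ s\<close> turns
        \<open>v (s - 1) / \<rho>\<close> into \<open>\<gamma> (s - 1)\<close> and
        \<open>\<rho> * v (s + 1)\<close> into \<open>\<gamma> (s + 1)\<close>.\<close>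
      finally have "((\<kappa> * real n + 1) * v s) * \<rho> ^ s \<le> ((real s / \<rho> * v (s - 1)
          + (q - 1) * \<rho> * (real n - real s) * v (s + 1)) + (q - 2) * real s * v s) * \<rho> ^ s"
        using \<rho> by (intro mult_right_mono) auto
      moreover have "\<rho> ^ s = \<rho> * \<rho> ^ (s - 1)" using s1 by (cases s) auto
      ultimately show ?thesis
        using \<rho> by (simp add: \<gamma>_def algebra_simps)
    qed
    moreover have "0 < \<gamma> t" using mt m0 \<rho> by (simp add: \<gamma>_def v_def)
    moreover have "0 \<le> \<gamma> s" for s using v \<rho> by (simp add: \<gamma>_def)
    moreover have "\<gamma> s = 0" if "t < s" for s using that by (auto simp: \<gamma>_def v_def)
    ultimately show "\<exists>\<gamma>. (\<forall>s. 0 \<le> \<gamma> s) \<and> (\<forall>s. nat \<lfloor>\<tau> * real n\<rfloor> < s \<longrightarrow> \<gamma> s = 0) \<and>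
      (\<exists>s\<le>n. 0 < \<gamma> s) \<and>
      (\<forall>s\<le>n. (\<kappa> * real n + 1) * \<gamma> s \<le>
        real s * (\<gamma> (s - 1) + (q - 2) * \<gamma> s) + (q - 1) * (real n - real s) * \<gamma> (s + 1))"
      using tn by (intro exI[of _ \<gamma>]) (auto simp flip: t_def)
  qed
qed

text \<open>Chernoff's bound with the \<open>r\<close> that minimises
  \<open>(1 + (q - 1) * r) ^ n\<close> over \<open>r\<close> to the power \<open>\<tau> n\<close>;
  the condition \<open>\<tau> \<le> 1 - 1 / q\<close> amounts to \<open>r \<le> 1\<close>.\<close>

lemma log_ball_volume_le:
  fixes b q \<tau> :: real
  assumes b: "1 < b" and q: "1 < q" and \<tau>: "0 < \<tau>" "\<tau> \<le> 1 - 1 / q"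
  shows "0 < (\<Sum>S | S \<subseteq> {..<n} \<and> card S \<le> nat \<lfloor>\<tau> * real n\<rfloor>. (q - 1) ^ card S)" (is "0 < ?S")
    and "log b (\<Sum>S | S \<subseteq> {..<n} \<and> card S \<le> nat \<lfloor>\<tau> * real n\<rfloor>. (q - 1) ^ card S)
      \<le> real n * H_entropy b q \<tau>"
proof -
  let ?t = "nat \<lfloor>\<tau> * real n\<rfloor>"
  define r where "r = \<tau> / ((1 - \<tau>) * (q - 1))"
  have \<tau>1: "\<tau> < 1" using \<tau> q by (smt (verit) divide_pos_pos)
  have r: "0 < r" using \<tau> \<tau>1 q by (simp add: r_def)
  have "\<tau> * q \<le> q - 1" using \<tau> q by (simp add: field_simps)
  then have "\<tau> \<le> (1 - \<tau>) * (q - 1)" by (simp add: algebra_simps)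
  then have r1: "r \<le> 1" using \<tau>1 q by (simp add: r_def)
  show pos: "0 < ?S"
    by (rule sum_pos2[where i = "{}"]) (use q in auto)
  have "(q - 1) * r = \<tau> / (1 - \<tau>)" using q by (simp add: r_def)
  then have "1 + (q - 1) * r = 1 / (1 - \<tau>)" using \<tau>1 by (simp add: field_simps)
  then have "?S \<le> (1 / (1 - \<tau>)) ^ n / r ^ ?t"
    using sum_Pow_tail_le[of "{..<n}" "q - 1" r ?t] q r r1 by simp
  then have "log b ?S \<le> log b ((1 / (1 - \<tau>)) ^ n / r ^ ?t)"
    using b pos \<tau>1 r by (subst log_le_cancel_iff) auto
  also have "\<dots> = - real n * log b (1 - \<tau>) - real ?t * log b r"
    using b \<tau>1 r by (simp add: log_divide_pos log_nat_power log_mult_pos)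
  \<comment> \<open>Rounding \<open>\<tau> n\<close> down costs nothing because
    \<open>log b r \<le> 0\<close>.\<close>
  also have "\<dots> \<le> - real n * log b (1 - \<tau>) - (\<tau> * real n) * log b r"
  proof -
    have "real ?t \<le> \<tau> * real n" using \<tau> by (simp add: of_nat_nat)
    moreover have "log b r \<le> 0" using b r r1 by (simp add: log_le_zero_cancel_iff)
    ultimately show ?thesis by (simp add: mult_right_mono_neg)
  qed
  also have "log b r = log b \<tau> - log b (1 - \<tau>) - log b (q - 1)"
    using b q \<tau> \<tau>1 by (simp add: r_def log_divide_pos log_mult_pos)
  finally show "log b ?S \<le> real n * H_entropy b q \<tau>"
    by (simp add: H_entropy_def algebra_simps)
qed

text \<open>With \<open>d = \<delta> n\<close> the constant \<open>c\<close> is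
  \<open>\<kappa> n\<close> for \<open>\<kappa> = q - 1 - q * \<delta>\<close>. The coefficients
  depend on \<open>n\<close> alone, so one threshold serves all codes \<open>C\<close>; the factor
  \<open>q * d\<close> leaves a logarithmic error.\<close>

lemma (in scheme_kernel) eventually_log_card_le:
  fixes b \<tau> \<delta> :: real
  assumes b: "1 < b" and \<delta>: "0 < \<delta>" and \<tau>: "0 < \<tau>" "\<tau> \<le> 1 - 1 / q"
    and strict: "q - 1 - q * \<delta> < (q - 2) * \<tau> + 2 * sqrt ((q - 1) * \<tau> * (1 - \<tau>))"
  shows "\<forall>\<^sub>F n in sequentially. \<forall>C. finite C \<longrightarrow> C \<noteq> {} \<longrightarrow> (\<forall>x\<in>C. \<forall>i<n. x i \<in> V) \<longrightarrow>
    (\<forall>x\<in>C. \<forall>y\<in>C. x \<noteq> y \<longrightarrow> (\<exists>i<n. x i \<noteq> y i \<and> B (x i) (y i) = 0) \<or>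
      \<delta> * real n \<le> real (card {i. i < n \<and> x i \<noteq> y i})) \<longrightarrow>
    1 / real n * log b (real (card C)) \<le> log b \<theta> + log b (q * \<delta> * real n) / real n + H_entropy b q \<tau>"
proof -
  have \<tau>1: "\<tau> < 1" using \<tau> q by (smt (verit) divide_pos_pos)
  from eventually_jacobi_vector[OF q \<tau>(1) \<tau>1 strict] eventually_gt_at_top[of "0::nat"]
  show ?thesis
  proof (rule eventually_elim2, intro allI impI)
    fix n :: nat and C :: "(nat \<Rightarrow> 'a) set"
    assume n: "0 < n" and C: "finite C" "C \<noteq> {}" "\<forall>x\<in>C. \<forall>i<n. x i \<in> V"
      and sep: "\<forall>x\<in>C. \<forall>y\<in>C. x \<noteq> y \<longrightarrow> (\<exists>i<n. x i \<noteq> y i \<and> B (x i) (y i) = 0) \<or>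
        \<delta> * real n \<le> real (card {i. i < n \<and> x i \<noteq> y i})"
      and ex: "\<exists>\<gamma>. (\<forall>s. 0 \<le> \<gamma> s) \<and> (\<forall>s. nat \<lfloor>\<tau> * real n\<rfloor> < s \<longrightarrow> \<gamma> s = 0) \<and>
        (\<exists>s\<le>n. 0 < \<gamma> s) \<and>
        (\<forall>s\<le>n. ((q - 1 - q * \<delta>) * real n + 1) * \<gamma> s \<le>
          real s * (\<gamma> (s - 1) + (q - 2) * \<gamma> s) + (q - 1) * (real n - real s) * \<gamma> (s + 1))"
    from ex obtain \<gamma> s0 where \<gamma>: "\<And>s. 0 \<le> \<gamma> s" "\<And>s. nat \<lfloor>\<tau> * real n\<rfloor> < s \<Longrightarrow> \<gamma> s = 0"
      "s0 \<le> n" "0 < \<gamma> s0"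
      and jacobi: "\<And>s. s \<le> n \<Longrightarrow> ((q - 1 - q * \<delta>) * real n + 1) * \<gamma> s \<le>
        real s * (\<gamma> (s - 1) + (q - 2) * \<gamma> s) + (q - 1) * (real n - real s) * \<gamma> (s + 1)"
      by blast
    let ?S = "\<Sum>S | S \<subseteq> {..<n} \<and> card S \<le> nat \<lfloor>\<tau> * real n\<rfloor>. (q - 1) ^ card S"
    have q1: "1 < q" using q by simp
    have S: "0 < ?S" "log b ?S \<le> real n * H_entropy b q \<tau>"
      by (rule log_ball_volume_le[OF b q1 \<tau>])+
    have shift: "(q - 1) * real n - q * (\<delta> * real n) + 1 = (q - 1 - q * \<delta>) * real n + 1"
      by (simp add: algebra_simps)
    have "real (card C) \<le> \<theta> ^ n * (q * (\<delta> * real n)) * ?S"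
    proof (rule linear_programming_bound_support[OF C(1,2)])
      show "((q - 1) * real n - q * (\<delta> * real n) + 1) * \<gamma> s \<le>
        real s * (\<gamma> (s - 1) + (q - 2) * \<gamma> s) + (q - 1) * (real n - real s) * \<gamma> (s + 1)" if "s \<le> n" for s
        unfolding shift by (rule jacobi[OF that])
    qed (use C sep \<gamma> \<delta> in auto)
    moreover have "0 < real (card C)" using C by (simp add: card_gt_0_iff)
    ultimately have "log b (real (card C)) \<le> log b (\<theta> ^ n * (q * \<delta> * real n) * ?S)"
      using b by (subst log_le_cancel_iff) (auto simp: mult.assoc intro: less_le_trans)
    also have "\<dots> = real n * log b \<theta> + log b (q * \<delta> * real n) + log b ?S"
      using b \<theta> q1 \<delta> n S by (simp add: log_mult_pos log_nat_power)
    also have "\<dots> \<le> real n * log b \<theta> + log b (q * \<delta> * real n) + real n * H_entropy b q \<tau>"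
      using S by simp
    finally show "1 / real n * log b (real (card C)) \<le> log b \<theta> + log b (q * \<delta> * real n) / real n + H_entropy b q \<tau>"
      using n by (simp add: field_simps)
  qed
qed

section \<open>The theta function of a vertex- and edge-transitive graph\<close>

text \<open>Constant vectors are eigenvectors of \<open>K\<close> with eigenvalue
  \<open>card V\<close>. Hence the form of \<open>K - 1\<close> at \<open>x\<close> is the form of
  \<open>K\<close> at \<open>x\<close> minus its mean \<open>\<mu>\<close>.\<close>

lemma psd_on_row_sums:
  assumes "finite V" "V \<noteq> {}" "psd_on V K" and row: "\<And>u. u \<in> V \<Longrightarrow> (\<Sum>v\<in>V. K u v) = real (card V)"
  shows "psd_on V (\<lambda>u v. K u v - 1)"
  unfolding psd_on_def
proof (intro conjI ballI allI)
  fix u v assume "u \<in> V" "v \<in> V"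
  then show "K u v - 1 = K v u - 1" using assms(3) by (simp add: psd_on_def)
next
  fix x :: "'a \<Rightarrow> real"
  let ?N = "real (card V)"
  define s where "s = (\<Sum>u\<in>V. x u)"
  define \<mu> where "\<mu> = s / ?N"
  have N: "?N \<noteq> 0" using assms by simp
  have sym: "K u v = K v u" if "u \<in> V" "v \<in> V" for u v
    using assms(3) that by (simp add: psd_on_def)
  have r1: "(\<Sum>u\<in>V. \<Sum>v\<in>V. x u * K u v) = ?N * s"
    using row by (simp add: sum_distrib_left[symmetric] s_def sum_distrib_right[symmetric])
  have r2: "(\<Sum>u\<in>V. \<Sum>v\<in>V. K u v * x v) = ?N * s"
    by (subst sum.swap, subst r1[symmetric], intro sum.cong) (auto simp: sym)
  have r3: "(\<Sum>u\<in>V. \<Sum>v\<in>V. K u v) = ?N * ?N"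
    using row by simp
  have "0 \<le> (\<Sum>u\<in>V. \<Sum>v\<in>V. (x u - \<mu>) * K u v * (x v - \<mu>))"
    by (rule psd_onD[OF assms(3)])
  also have "\<dots> = (\<Sum>u\<in>V. \<Sum>v\<in>V. x u * K u v * x v - \<mu> * (x u * K u v) - \<mu> * (K u v * x v) + \<mu>\<^sup>2 * K u v)"
    by (intro sum.cong) (auto simp: algebra_simps power2_eq_square)
  also have "\<dots> = (\<Sum>u\<in>V. \<Sum>v\<in>V. x u * K u v * x v) - \<mu> * (?N * s) - \<mu> * (?N * s) + \<mu>\<^sup>2 * (?N * ?N)"
  proof -
    have "(\<Sum>u\<in>V. \<Sum>v\<in>V. \<mu> * (x u * K u v)) = \<mu> * (?N * s)"
      unfolding r1[symmetric] sum_distrib_left by (rule refl)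
    moreover have "(\<Sum>u\<in>V. \<Sum>v\<in>V. \<mu> * (K u v * x v)) = \<mu> * (?N * s)"
      unfolding r2[symmetric] sum_distrib_left by (rule refl)
    moreover have "(\<Sum>u\<in>V. \<Sum>v\<in>V. \<mu>\<^sup>2 * K u v) = \<mu>\<^sup>2 * (?N * ?N)"
      unfolding r3[symmetric] sum_distrib_left by (rule refl)
    ultimately show ?thesis by (simp only: sum.distrib sum_subtractf)
  qed
  also have "\<dots> = (\<Sum>u\<in>V. \<Sum>v\<in>V. x u * K u v * x v) - s\<^sup>2"
    using N by (simp add: \<mu>_def power2_eq_square field_simps)
  also have "s\<^sup>2 = (\<Sum>u\<in>V. \<Sum>v\<in>V. x u * x v)"
    by (simp add: s_def power2_eq_square sum_product)
  finally show "0 \<le> (\<Sum>u\<in>V. \<Sum>v\<in>V. x u * (K u v - 1) * x v)"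
    by (simp add: algebra_simps sum_subtractf)
qed

section \<open>Averaging over the automorphism group\<close>

lemma psd_on_sum:
  assumes "finite I" "\<And>i. i \<in> I \<Longrightarrow> psd_on V (K i)"
  shows "psd_on V (\<lambda>u v. \<Sum>i\<in>I. K i u v)"
  using assms by (induction I rule: finite_induct) (simp_all add: psd_on_const psd_on_add)

lemma automorphism_compose:
  assumes "automorphism G f" "automorphism G g"
  shows "automorphism G (g \<circ> f)"
  using assms bij_betwE[of f "pverts G" "pverts G"] bij_betw_trans[of f "pverts G" "pverts G" g "pverts G"]
  by (auto simp: automorphism_def)

lemma automorphism_inverse:
  assumes "automorphism G f"
  shows "automorphism G (inv_into (pverts G) f)"
proof -
  let ?g = "inv_into (pverts G) f"
  have f: "bij_betw f (pverts G) (pverts G)" using assms by (simp add: automorphism_def)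
  have g: "bij_betw ?g (pverts G) (pverts G)" by (rule bij_betw_inv_into[OF f])
  have "f (?g u) = u" "?g u \<in> pverts G" if "u \<in> pverts G" for u
    using that f g by (auto simp: bij_betw_inv_into_right dest: bij_betwE)
  then show ?thesis
    using assms g by (simp add: automorphism_def) metis
qed

text \<open>Restricting to extensional functions makes the automorphism group finite.\<close>

definition automorphism_group :: "'a pair_pre_digraph \<Rightarrow> ('a \<Rightarrow> 'a) set" where
  "automorphism_group G = {f \<in> extensional (pverts G). automorphism G f}"

lemma automorphism_cong:
  assumes "\<And>v. v \<in> pverts G \<Longrightarrow> f v = g v"
  shows "automorphism G f \<longleftrightarrow> automorphism G g"
  using assms by (simp add: automorphism_def cong: bij_betw_cong)

lemma finite_automorphism_group:
  assumes "finite (pverts G)"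
  shows "finite (automorphism_group G)"
proof (rule finite_subset)
  show "automorphism_group G \<subseteq> pverts G \<rightarrow>\<^sub>E pverts G"
    by (auto simp: automorphism_group_def automorphism_def PiE_iff dest: bij_betwE intro: extensional_arb)
qed (use assms in \<open>auto intro: finite_PiE\<close>)

lemma automorphism_group_nonempty: "automorphism_group G \<noteq> {}"
proof -
  have "automorphism G (restrict id (pverts G))"
    by (subst automorphism_cong[where g = id]) (auto simp: automorphism_def)
  then show ?thesis by (auto simp: automorphism_group_def)
qed

text \<open>Right translation by \<open>g\<close> permutes the group; restriction keeps the
  composites extensional.\<close>

lemma sum_automorphism_group_translate:
  fixes F :: "'a \<Rightarrow> 'a \<Rightarrow> real"
  assumes g: "automorphism G g" and uv: "u \<in> pverts G" "v \<in> pverts G"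
  shows "(\<Sum>f\<in>automorphism_group G. F (f (g u)) (f (g v))) = (\<Sum>f\<in>automorphism_group G. F (f u) (f v))"
proof (rule sum.reindex_bij_witness[where i = "\<lambda>f. restrict (f \<circ> inv_into (pverts G) g) (pverts G)"
      and j = "\<lambda>f. restrict (f \<circ> g) (pverts G)"])
  let ?V = "pverts G"
  have b: "bij_betw g ?V ?V" using g by (simp add: automorphism_def)
  have app: "g w \<in> ?V" "inv_into ?V g w \<in> ?V" "inv_into ?V g (g w) = w" "g (inv_into ?V g w) = w"
    if "w \<in> ?V" for w
    using that b bij_betw_inv_into[OF b]
    by (auto simp: bij_betw_inv_into_left bij_betw_inv_into_right dest: bij_betwE)
  have mem: "restrict (f \<circ> k) ?V \<in> automorphism_group G"
    if "f \<in> automorphism_group G" "automorphism G k" for f k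
    using that automorphism_compose[of G k f]
    by (auto simp: automorphism_group_def cong: automorphism_cong)
  fix f assume f: "f \<in> automorphism_group G"
  then have ext: "f \<in> extensional ?V" by (simp add: automorphism_group_def)
  show "restrict (restrict (f \<circ> g) ?V \<circ> inv_into ?V g) ?V = f"
    "restrict (restrict (f \<circ> inv_into ?V g) ?V \<circ> g) ?V = f"
    using ext app by (auto simp: fun_eq_iff restrict_def extensional_def)
  show "restrict (f \<circ> g) ?V \<in> automorphism_group G"
    "restrict (f \<circ> inv_into ?V g) ?V \<in> automorphism_group G"
    using mem[OF f] g automorphism_inverse[OF g] by auto
  show "F (restrict (f \<circ> g) ?V u) (restrict (f \<circ> g) ?V v) = F (f (g u)) (f (g v))"
    using uv by simp
qed

definition adjacency :: "'a pair_pre_digraph \<Rightarrow> 'a \<Rightarrow> 'a \<Rightarrow> real" where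
  "adjacency G u v = (if (u, v) \<in> parcs G then 1 else 0)"

text \<open>Feasibility is convex and invariant under automorphisms, so the average \<open>S\<close>
  of \<open>T\<close> over the group is feasible. Transitivity on vertices makes its diagonal
  constant, transitivity on edges its entries at arcs.\<close>

lemma theta_feasible_average:
  assumes G: "pair_graph G" "vertex_transitive G" "edge_transitive G" "edge_set G \<noteq> {}"
    and T: "theta_feasible G T"
  obtains t c where "t \<le> theta_value G T"
    "psd_on (pverts G) (\<lambda>u v. (if u = v then t else 0) + c * adjacency G u v - 1)"
proof -
  interpret pair_graph G by fact
  let ?V = "pverts G" and ?\<Gamma> = "automorphism_group G"
  have fin: "finite ?V" by simp
  have fin\<Gamma>: "finite ?\<Gamma>" by (rule finite_automorphism_group[OF fin])
  have card\<Gamma>: "0 < real (card ?\<Gamma>)"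
    using fin\<Gamma> automorphism_group_nonempty[of G] by (simp add: card_gt_0_iff)
  have aut: "automorphism G f" if "f \<in> ?\<Gamma>" for f
    using that by (simp add: automorphism_group_def)
  define S where "S u v = (\<Sum>f\<in>?\<Gamma>. T (f u) (f v)) / real (card ?\<Gamma>)" for u v
  have inv: "S (g u) (g v) = S u v" if "automorphism G g" "u \<in> ?V" "v \<in> ?V" for g u v
    unfolding S_def by (simp add: sum_automorphism_group_translate[OF that])
  have Tsym: "T u v = T v u" if "u \<in> ?V" "v \<in> ?V" for u v
    using T that by (auto simp: theta_feasible_def psd_on_def)
  have bij: "bij_betw f ?V ?V" if "f \<in> ?\<Gamma>" for f
    using aut[OF that] by (simp add: automorphism_def)
  have mem: "f v \<in> ?V" if "f \<in> ?\<Gamma>" "v \<in> ?V" for f v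
    using bij_betw_apply[OF bij] that by blast
  have Ssym: "S u v = S v u" if "u \<in> ?V" "v \<in> ?V" for u v
  proof -
    have "(\<Sum>f\<in>?\<Gamma>. T (f u) (f v)) = (\<Sum>f\<in>?\<Gamma>. T (f v) (f u))"
      by (rule sum.cong[OF refl]) (rule Tsym[OF mem[OF _ that(1)] mem[OF _ that(2)]])
    then show ?thesis by (simp add: S_def)
  qed
  have psd: "psd_on ?V (\<lambda>u v. S u v - 1)"
  proof -
    have "psd_on ?V (\<lambda>u v. T (f u) (f v) - 1)" if f: "f \<in> ?\<Gamma>" for f
    proof -
      have "psd_on ?V (\<lambda>u v. T u v - 1)" using T by (simp add: theta_feasible_def)
      moreover have "f ` ?V \<subseteq> ?V" using bij[OF f] by (simp add: bij_betw_def)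
      ultimately have "psd_on ?V (\<lambda>u v. 1 * (T (f u) (f v) - 1))"
        by (rule psd_on_mult_pullback[OF fin psd_on_const[OF zero_le_one] fin])
      then show ?thesis by simp
    qed
    then have "psd_on ?V (\<lambda>u v. \<Sum>f\<in>?\<Gamma>. T (f u) (f v) - 1)"
      by (rule psd_on_sum[OF fin\<Gamma>])
    then have "psd_on ?V (\<lambda>u v. (1 / real (card ?\<Gamma>)) * (\<Sum>f\<in>?\<Gamma>. T (f u) (f v) - 1))"
      by (rule psd_on_scale) simp
    moreover have "(1 / real (card ?\<Gamma>)) * (\<Sum>f\<in>?\<Gamma>. T (f u) (f v) - 1) = S u v - 1" for u v
      using card\<Gamma> by (simp add: S_def sum_subtractf diff_divide_distrib)
    ultimately show ?thesis by simp
  qed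
  obtain a b where ab: "(a, b) \<in> parcs G"
    using G(4) by (auto simp: edge_set_def)
  then have abV: "a \<in> ?V" "b \<in> ?V" by (auto intro: in_arcsD1 in_arcsD2)
  have diag: "S v v = S a a" if v: "v \<in> ?V" for v
  proof -
    obtain f where "automorphism G f" "f v = a"
      using G(2) v abV unfolding vertex_transitive_def by blast
    then show ?thesis using inv[of f v v] v by simp
  qed
  have edge: "S u v = S a b" if uv: "(u, v) \<in> parcs G" for u v
  proof -
    have uvV: "u \<in> ?V" "v \<in> ?V" using uv by (auto intro: in_arcsD1 in_arcsD2)
    have "{a, b} \<in> edge_set G" "{u, v} \<in> edge_set G"
      using ab uv by (auto simp: edge_set_def)
    then obtain f where f: "automorphism G f" "f ` {a, b} = {u, v}"
      using G(3) unfolding edge_transitive_def by blast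
    \<comment> \<open>Transitivity concerns undirected edges, so \<open>f\<close> may reverse the
      arc; symmetry of \<open>S\<close> repairs this.\<close>
    then have "f a = u \<and> f b = v \<or> f a = v \<and> f b = u" by (auto simp: doubleton_eq_iff)
    then show ?thesis
    proof
      assume "f a = u \<and> f b = v"
      then show ?thesis using inv[OF f(1) abV] by simp
    next
      assume "f a = v \<and> f b = u"
      then show ?thesis using inv[OF f(1) abV] Ssym[OF uvV] by simp
    qed
  qed
  have nonedge: "S u v = 0" if "u \<in> ?V" "v \<in> ?V" "u \<noteq> v" "(u, v) \<notin> parcs G" for u v
  proof -
    have "T (f u) (f v) = 0" if f: "f \<in> ?\<Gamma>" for f
    proof -
      have "f u \<noteq> f v" using bij[OF f] \<open>u \<in> ?V\<close> \<open>v \<in> ?V\<close> \<open>u \<noteq> v\<close>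
        by (auto simp: bij_betw_def inj_on_def)
      moreover have "(f u, f v) \<notin> parcs G"
        using aut[OF f] that \<open>u \<in> ?V\<close> \<open>v \<in> ?V\<close> \<open>(u, v) \<notin> parcs G\<close> by (simp add: automorphism_def)
      ultimately show ?thesis
        using T mem[OF f \<open>u \<in> ?V\<close>] mem[OF f \<open>v \<in> ?V\<close>] by (auto simp: theta_feasible_def)
    qed
    then show ?thesis by (simp add: S_def)
  qed
  have entries: "S u v = (if u = v then S a a else 0) + S a b * adjacency G u v"
    if uv: "u \<in> ?V" "v \<in> ?V" for u v
  proof (cases "u = v")
    case True
    moreover have "(v, v) \<notin> parcs G" using pair_no_loops by fastforce
    ultimately show ?thesis using diag[OF uv(2)] by (simp add: adjacency_def)
  next
    case False
    then show ?thesis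
      using edge[of u v] nonedge[OF uv False] by (cases "(u, v) \<in> parcs G") (simp_all add: adjacency_def)
  qed
  have "psd_on ?V (\<lambda>u v. (if u = v then S a a else 0) + S a b * adjacency G u v - 1)"
    by (rule iffD1[OF psd_on_cong psd]) (rule arg_cong2[where f = "(-)", OF entries refl])
  moreover have "S a a \<le> theta_value G T"
  proof -
    have "(\<Sum>f\<in>?\<Gamma>. T (f a) (f a)) \<le> (\<Sum>f\<in>?\<Gamma>. theta_value G T)"
      by (rule sum_mono) (rule theta_value_ge[OF fin mem[OF _ abV(1)]])
    then show ?thesis using card\<Gamma> by (simp add: S_def field_simps)
  qed
  ultimately show ?thesis using that by blast
qed

text \<open>The signless Laplacian (\<open>s = 1\<close>) and the Laplacian (\<open>s = -1\<close>)
  of a regular graph: the form is half the sum of \<open>(x u + s * x v)\<^sup>2\<close> over all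
  arcs.\<close>

lemma psd_adjacency:
  assumes fin: "finite (pverts G)" and sym: "\<And>u v. (u, v) \<in> parcs G \<Longrightarrow> (v, u) \<in> parcs G"
    and deg: "\<And>u. u \<in> pverts G \<Longrightarrow> (\<Sum>v\<in>pverts G. adjacency G u v) = D" and s: "s\<^sup>2 = 1"
  shows "psd_on (pverts G) (\<lambda>u v. (if u = v then D else 0) + s * adjacency G u v)"
  unfolding psd_on_def
proof (intro conjI ballI allI)
  fix u v
  show "(if u = v then D else 0) + s * adjacency G u v = (if v = u then D else 0) + s * adjacency G v u"
    using sym by (auto simp: adjacency_def)
next
  fix x :: "'a \<Rightarrow> real"
  let ?V = "pverts G" and ?A = "adjacency G"
  have symA: "?A u v = ?A v u" for u v using sym by (auto simp: adjacency_def)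
  have d1: "(\<Sum>u\<in>?V. \<Sum>v\<in>?V. ?A u v * (x u)\<^sup>2) = D * (\<Sum>u\<in>?V. (x u)\<^sup>2)"
    using deg by (simp add: sum_distrib_right[symmetric] sum_distrib_left)
  have d2: "(\<Sum>u\<in>?V. \<Sum>v\<in>?V. ?A u v * (x v)\<^sup>2) = D * (\<Sum>u\<in>?V. (x u)\<^sup>2)"
    by (subst sum.swap, subst d1[symmetric], subst symA) (rule refl)
  have "0 \<le> (\<Sum>u\<in>?V. \<Sum>v\<in>?V. ?A u v * (x u + s * x v)\<^sup>2)"
    by (intro sum_nonneg mult_nonneg_nonneg) (auto simp: adjacency_def)
  also have "\<dots> = (\<Sum>u\<in>?V. \<Sum>v\<in>?V. ?A u v * (x u)\<^sup>2 + ?A u v * (x v)\<^sup>2 + 2 * (x u * (s * ?A u v) * x v))"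
    using s by (intro sum.cong refl) (simp add: power2_sum power_mult_distrib algebra_simps)
  also have "\<dots> = 2 * (D * (\<Sum>u\<in>?V. (x u)\<^sup>2) + (\<Sum>u\<in>?V. \<Sum>v\<in>?V. x u * (s * ?A u v) * x v))"
    by (simp only: sum.distrib d1 d2 sum_distrib_left[symmetric]) simp
  also have "D * (\<Sum>u\<in>?V. (x u)\<^sup>2) = (\<Sum>u\<in>?V. \<Sum>v\<in>?V. x u * (if u = v then D else 0) * x v)"
    using fin by (simp add: sum_distrib_left power2_eq_square if_distrib[of "\<lambda>t. t * _"]
        if_distrib[of "(*) _"] mult_ac cong: if_cong)
  finally show "0 \<le> (\<Sum>u\<in>?V. \<Sum>v\<in>?V. x u * ((if u = v then D else 0) + s * ?A u v) * x v)"
    by (simp add: algebra_simps sum.distrib)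
qed

lemma lovasz_theta_transitive:
  assumes G: "pair_graph G" "vertex_transitive G" "edge_transitive G" "edge_set G \<noteq> {}"
  defines "\<theta> \<equiv> lovasz_theta G" and "N \<equiv> real (card (pverts G))"
  obtains c where "1 \<le> \<theta>" "2 * \<theta> \<le> N" "0 \<le> c"
    "psd_on (pverts G) (\<lambda>u v. (if u = v then \<theta> else 0) + c * adjacency G u v - 1)"
    "psd_on (pverts G) (\<lambda>u v. (if u = v then N - \<theta> else 0) - c * adjacency G u v)"
proof -
  interpret pair_graph G by fact
  let ?V = "pverts G" and ?A = "adjacency G"
  have fin: "finite ?V" by simp
  obtain a b where ab: "(a, b) \<in> parcs G"
    using G(4) by (auto simp: edge_set_def)
  then have abV: "a \<in> ?V" "b \<in> ?V" by (auto intro: in_arcsD1 in_arcsD2)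
  then have ne: "?V \<noteq> {}" by auto
  have sym: "(v, u) \<in> parcs G" if "(u, v) \<in> parcs G" for u v
    using that pair_sym_arcs by (auto simp: symmetric_def dest: symD)
  have noloop: "(u, u) \<notin> parcs G" for u using pair_no_loops by fastforce
  have N: "0 < N" using fin ne by (simp add: N_def card_gt_0_iff)
  define D where "D = (\<Sum>v\<in>?V. ?A a v)"
  have deg: "(\<Sum>v\<in>?V. ?A u v) = D" if u: "u \<in> ?V" for u
  proof -
    obtain f where f: "automorphism G f" "f u = a"
      using G(2) u abV unfolding vertex_transitive_def by blast
    then have bij: "bij_betw f ?V ?V" by (simp add: automorphism_def)
    have "D = (\<Sum>v\<in>?V. ?A a (f v))"
      unfolding D_def by (rule sum.reindex_bij_betw[OF bij, symmetric])
    also have "\<dots> = (\<Sum>v\<in>?V. ?A u v)"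
      using f u by (intro sum.cong) (auto simp: automorphism_def adjacency_def)
    finally show ?thesis by simp
  qed
  have D: "0 < D"
    unfolding D_def by (rule sum_pos2[where i = b]) (use fin abV ab in \<open>auto simp: adjacency_def\<close>)
  define K where "K t c u v = (if u = v then t else 0) + c * ?A u v" for t c :: real and u v
  have row: "(\<Sum>v\<in>?V. K t c u v) = t + c * D" if "u \<in> ?V" for t c u
    using that fin by (simp add: K_def sum.distrib deg sum_distrib_left[symmetric])
  have feasible: "lovasz_theta G \<le> t \<and> theta_feasible G (K t c)"
    if "psd_on ?V (\<lambda>u v. K t c u v - 1)" for t c
  proof -
    have "theta_feasible G (K t c)"
      using that by (auto simp: theta_feasible_def K_def adjacency_def)
    moreover have "theta_value G (K t c) = t"
      using ne by (simp add: theta_value_def K_def adjacency_def noloop)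
    ultimately show ?thesis using lovasz_theta_le[OF fin ne] by metis
  qed
  have normalised: "psd_on ?V (\<lambda>u v. K t c u v - 1)" if "psd_on ?V (K t c)" "t + c * D = N" for t c
    using that row by (intro psd_on_row_sums fin ne) (simp_all add: N_def)
  obtain T where T: "theta_feasible G T" "theta_value G T = \<theta>"
    using lovasz_theta_attained[OF fin ne] \<theta>_def by auto
  obtain t c where "t \<le> \<theta>" and "psd_on ?V (\<lambda>u v. K t c u v - 1)"
    using theta_feasible_average[OF G T(1)] unfolding T(2) K_def by blast
  moreover from this(2) feasible[of t c] have "\<theta> \<le> t" unfolding \<theta>_def by blast
  ultimately have psd: "psd_on ?V (\<lambda>u v. K \<theta> c u v - 1)" by simp
  have \<theta>1: "1 \<le> \<theta>"
    using theta_feasible_diag[OF fin abV(1) T(1)] theta_value_ge[OF fin abV(1), of T] T(2) by simp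
  have psdK: "psd_on ?V (K \<theta> c)"
    using psd_on_add[OF psd psd_on_const[of 1]] by simp
  have ge: "N \<le> \<theta> + c * D"
  proof -
    have "0 \<le> (\<Sum>u\<in>?V. \<Sum>v\<in>?V. K \<theta> c u v - 1)"
      using psd_onD[OF psd, of "\<lambda>_. 1"] by simp
    also have "\<dots> = N * (\<theta> + c * D) - N * N"
      by (simp add: sum_subtractf row N_def right_diff_distrib)
    finally show ?thesis using N by simp
  qed
  \<comment> \<open>If the row sums exceeded \<open>N\<close>, scaling them down to \<open>N\<close>
    would by \<open>normalised\<close> keep feasibility and give a value below
    \<open>\<theta>\<close>.\<close>
  have eq: "\<theta> + c * D = N"
  proof (rule ccontr)
    assume "\<theta> + c * D \<noteq> N"
    with ge have gt: "N < \<theta> + c * D" by simp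
    define s where "s = N / (\<theta> + c * D)"
    have s: "0 < s" "s < 1" using gt N by (simp_all add: s_def)
    have "K (s * \<theta>) (s * c) = (\<lambda>u v. s * K \<theta> c u v)"
      by (auto simp: K_def fun_eq_iff algebra_simps)
    then have "psd_on ?V (K (s * \<theta>) (s * c))"
      using s by (simp add: psd_on_scale psdK)
    moreover have "s * \<theta> + s * c * D = N"
    proof -
      have "s * \<theta> + s * c * D = s * (\<theta> + c * D)" by (simp add: algebra_simps)
      also have "\<dots> = N" using gt N by (simp add: s_def)
      finally show ?thesis .
    qed
    ultimately have "psd_on ?V (\<lambda>u v. K (s * \<theta>) (s * c) u v - 1)" by (rule normalised)
    from feasible[OF this] have "1 * \<theta> \<le> s * \<theta>" unfolding \<theta>_def[symmetric] by simp
    with s \<theta>1 show False by (simp only: mult_le_cancel_right) linarith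
  qed
  have adj: "psd_on ?V (\<lambda>u v. (if u = v then D else 0) + s * ?A u v)" if "s\<^sup>2 = 1" for s
    by (rule psd_adjacency[OF fin sym deg that])
  \<comment> \<open>The signless Laplacian, scaled to row sums \<open>N\<close>, is feasible and has
    diagonal \<open>N / 2\<close>.\<close>
  have half: "2 * \<theta> \<le> N"
  proof -
    have "psd_on ?V (\<lambda>u v. N / (2 * D) * ((if u = v then D else 0) + 1 * ?A u v))"
      by (rule psd_on_scale[OF adj]) (use D N in auto)
    moreover have "(\<lambda>u v. N / (2 * D) * ((if u = v then D else 0) + 1 * ?A u v)) = K (N / 2) (N / (2 * D))"
      using D by (auto simp: K_def fun_eq_iff algebra_simps)
    ultimately have "psd_on ?V (K (N / 2) (N / (2 * D)))" by simp
    then have "psd_on ?V (\<lambda>u v. K (N / 2) (N / (2 * D)) u v - 1)"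
      by (rule normalised) (use D in \<open>simp add: field_simps\<close>)
    from feasible[OF this] have "\<theta> \<le> N / 2" unfolding \<theta>_def[symmetric] by simp
    then show ?thesis by simp
  qed
  have cD: "c * D = N - \<theta>" using eq by simp
  have c: "0 \<le> c"
  proof (rule ccontr)
    assume "\<not> 0 \<le> c"
    then have "c * D < 0" using D by (simp add: mult_neg_pos)
    with cD half \<theta>1 show False by linarith
  qed
  \<comment> \<open>The Laplacian times \<open>c\<close>, whose diagonal entry \<open>c * D\<close>
    is \<open>N - \<theta>\<close>.\<close>
  have "psd_on ?V (\<lambda>u v. c * ((if u = v then D else 0) + (- 1) * ?A u v))"
    by (rule psd_on_scale[OF adj]) (use c in auto)
  moreover have "(\<lambda>u v. c * ((if u = v then D else 0) + (- 1) * ?A u v))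
      = (\<lambda>u v. (if u = v then N - \<theta> else 0) - c * ?A u v)"
    unfolding cD[symmetric] by (auto simp: fun_eq_iff algebra_simps)
  ultimately show ?thesis
    using that[OF \<theta>1 half c] psd by (simp add: K_def)
qed

lemma scheme_kernel_transitive:
  assumes G: "pair_graph G" "vertex_transitive G" "edge_transitive G" "edge_set G \<noteq> {}"
  obtains B where "scheme_kernel (pverts G) B (real (card (pverts G)) / lovasz_theta G) (lovasz_theta G)"
    "\<And>u v. (u, v) \<notin> parcs G \<Longrightarrow> B u v = 0"
proof -
  let ?\<theta> = "lovasz_theta G" and ?N = "real (card (pverts G))"
  interpret pair_graph G by fact
  obtain c where c: "1 \<le> ?\<theta>" "2 * ?\<theta> \<le> ?N" "0 \<le> c"
    and psd1: "psd_on (pverts G) (\<lambda>u v. (if u = v then ?\<theta> else 0) + c * adjacency G u v - 1)"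
    and psd2: "psd_on (pverts G) (\<lambda>u v. (if u = v then ?N - ?\<theta> else 0) - c * adjacency G u v)"
    using lovasz_theta_transitive[OF G] .
  define B where "B u v = c / ?\<theta> * adjacency G u v" for u v
  have loop: "adjacency G u u = 0" for u
    using pair_no_loops by (fastforce simp: adjacency_def)
  have "scheme_kernel (pverts G) B (?N / ?\<theta>) ?\<theta>"
  proof
    show "finite (pverts G)" by simp
    show "2 \<le> ?N / ?\<theta>" using c by (simp add: field_simps)
    show "0 < ?\<theta>" using c by simp
    show "0 \<le> B u v" for u v using c by (simp add: B_def adjacency_def)
    have "psd_on (pverts G) (\<lambda>u v. (1 / ?\<theta>) * ((if u = v then ?\<theta> else 0) + c * adjacency G u v - 1))"
      using c by (intro psd_on_scale psd1) simp
    moreover have "(\<lambda>u v. (1 / ?\<theta>) * ((if u = v then ?\<theta> else 0) + c * adjacency G u v - 1))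
        = (\<lambda>u v. (if u = v then 1 else B u v) - 1 / ?\<theta>)"
      using c by (auto simp: fun_eq_iff B_def loop field_simps)
    ultimately show "psd_on (pverts G) (\<lambda>u v. (if u = v then 1 else B u v) - 1 / ?\<theta>)" by simp
    have "psd_on (pverts G) (\<lambda>u v. (1 / ?\<theta>) * ((if u = v then ?N - ?\<theta> else 0) - c * adjacency G u v))"
      using c by (intro psd_on_scale psd2) simp
    moreover have "(\<lambda>u v. (1 / ?\<theta>) * ((if u = v then ?N - ?\<theta> else 0) - c * adjacency G u v))
        = (\<lambda>u v. if u = v then ?N / ?\<theta> - 1 else - B u v)"
      using c by (auto simp: fun_eq_iff B_def loop field_simps)
    ultimately show "psd_on (pverts G) (\<lambda>u v. if u = v then ?N / ?\<theta> - 1 else - B u v)" by simp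
  qed
  moreover have "B u v = 0" if "(u, v) \<notin> parcs G" for u v
    using that by (simp add: B_def adjacency_def)
  ultimately show ?thesis using that by blast
qed

section \<open>The asymptotic bound\<close>

text \<open>The last claim, squared, is the equality case of the hypothesis \<open>strict\<close> of
  \<open>eventually_log_card_le\<close>. The square roots \<open>x\<close>, \<open>y\<close>,
  \<open>z\<close> of \<open>\<delta>\<close>, \<open>1 - \<delta>\<close>, \<open>q - 1\<close>
  give \<open>q * \<tau> = (z * y - x)\<^sup>2\<close> and
  \<open>q * (1 - \<tau>) = (y + z * x)\<^sup>2\<close>.\<close>

lemma LP1_critical_point:
  fixes q \<delta> :: real
  assumes q: "2 \<le> q" and \<delta>: "0 < \<delta>" "\<delta> < 1 - 1 / q"
  defines "\<tau> \<equiv> ((q - 1) - (q - 2) * \<delta> - 2 * sqrt ((q - 1) * \<delta> * (1 - \<delta>))) / q"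
  shows "0 \<le> \<tau>" and "\<tau> < 1 - 1 / q"
    and "sqrt ((q - 1) * (1 - \<tau>)) - sqrt \<tau> = sqrt (q * \<delta>)"
proof -
  have \<delta>1: "\<delta> < 1" using \<delta> q by (smt (verit) divide_pos_pos)
  define x y z where "x = sqrt \<delta>" and "y = sqrt (1 - \<delta>)" and "z = sqrt (q - 1)"
  have sq: "x * x = \<delta>" "y * y = 1 - \<delta>" "z * z = q - 1" and pos: "0 < x" "0 < y" "0 < z"
    using \<delta> \<delta>1 q by (simp_all add: x_def y_def z_def)
  have root: "sqrt ((q - 1) * \<delta> * (1 - \<delta>)) = z * x * y"
    by (simp add: x_def y_def z_def real_sqrt_mult)
  have "q * \<delta> < q - 1" using \<delta> q by (simp add: field_simps)
  then have "x\<^sup>2 < (z * y)\<^sup>2" by (simp add: power2_eq_square sq algebra_simps)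
  then have less: "x < z * y" by (rule power2_less_imp_less) (use pos in simp)
  have \<tau>: "\<tau> = (z * y - x)\<^sup>2 / q"
  proof -
    have "(z * y - x)\<^sup>2 = (z * z) * (y * y) + x * x - 2 * (z * x * y)"
      by (simp add: power2_eq_square algebra_simps)
    then show ?thesis unfolding \<tau>_def root sq by (simp add: algebra_simps)
  qed
  have \<tau>c: "1 - \<tau> = (y + z * x)\<^sup>2 / q"
  proof -
    have "(y + z * x)\<^sup>2 = y * y + (z * z) * (x * x) + 2 * (z * x * y)"
      by (simp add: power2_eq_square algebra_simps)
    then show ?thesis unfolding \<tau>_def root sq using q by (simp add: field_simps)
  qed
  show "0 \<le> \<tau>" using q by (simp add: \<tau>)
  have "0 < (q - 2) * \<delta> + 2 * (z * x * y)" using pos q \<delta> by (intro add_nonneg_pos) auto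
  moreover have "\<tau> = 1 - 1 / q - ((q - 2) * \<delta> + 2 * (z * x * y)) / q"
    unfolding \<tau>_def root using q by (simp add: field_simps)
  ultimately show "\<tau> < 1 - 1 / q" using q by simp
  have "sqrt \<tau> = (z * y - x) / sqrt q"
    using less by (simp add: \<tau> real_sqrt_divide)
  moreover have "sqrt ((q - 1) * (1 - \<tau>)) = z * (y + z * x) / sqrt q"
    using pos by (simp add: \<tau>c real_sqrt_divide real_sqrt_mult z_def)
  ultimately have "sqrt ((q - 1) * (1 - \<tau>)) - sqrt \<tau> = (z * z * x + x) / sqrt q"
    by (simp add: algebra_simps diff_divide_distrib add_divide_distrib)
  also have "\<dots> = q * x / sqrt q" unfolding sq by (simp add: algebra_simps)
  also have "\<dots> = sqrt (q * \<delta>)"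
    using q by (simp add: real_sqrt_mult x_def field_simps)
  finally show "sqrt ((q - 1) * (1 - \<tau>)) - sqrt \<tau> = sqrt (q * \<delta>)" .
qed

text \<open>The left side of \<open>root\<close> strictly decreases in \<open>\<tau>\<close> and is
  nonnegative up to \<open>1 - 1 / q\<close>, so moving to \<open>\<tau>'\<close> makes the
  inequality strict and squaring preserves it.\<close>

lemma LP1_threshold:
  fixes q \<delta> \<tau> \<tau>' :: real
  assumes q: "2 \<le> q" and \<tau>: "0 \<le> \<tau>" "\<tau> < \<tau>'" "\<tau>' \<le> 1 - 1 / q"
    and root: "sqrt ((q - 1) * (1 - \<tau>)) - sqrt \<tau> \<le> sqrt (q * \<delta>)" and \<delta>: "0 < \<delta>"
  shows "q - 1 - q * \<delta> < (q - 2) * \<tau>' + 2 * sqrt ((q - 1) * \<tau>' * (1 - \<tau>'))"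
proof -
  have \<tau>1: "\<tau>' < 1" using \<tau> q by (smt (verit) divide_pos_pos)
  have "\<tau>' * q \<le> q - 1" using \<tau> q by (simp add: field_simps)
  then have "\<tau>' \<le> (q - 1) * (1 - \<tau>')" by (simp add: algebra_simps)
  then have nn: "0 \<le> sqrt ((q - 1) * (1 - \<tau>')) - sqrt \<tau>'" by simp
  have "sqrt ((q - 1) * (1 - \<tau>')) - sqrt \<tau>' < sqrt ((q - 1) * (1 - \<tau>)) - sqrt \<tau>"
    using \<tau> q by (intro diff_strict_mono) auto
  with root have "sqrt ((q - 1) * (1 - \<tau>')) - sqrt \<tau>' < sqrt (q * \<delta>)" by simp
  then have "(sqrt ((q - 1) * (1 - \<tau>')) - sqrt \<tau>')\<^sup>2 < (sqrt (q * \<delta>))\<^sup>2"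
    using nn by (rule power_strict_mono) simp
  moreover have "(sqrt (q * \<delta>))\<^sup>2 = q * \<delta>" using q \<delta> by simp
  moreover have "(sqrt ((q - 1) * (1 - \<tau>')) - sqrt \<tau>')\<^sup>2
      = (q - 1) * (1 - \<tau>') + \<tau>' - 2 * sqrt ((q - 1) * \<tau>' * (1 - \<tau>'))"
    using q \<tau> \<tau>1 by (simp add: power2_diff real_sqrt_mult[symmetric] mult_ac)
  ultimately show ?thesis by (simp add: algebra_simps)
qed

lemma tendsto_H_entropy_at_right:
  assumes "1 < b" "0 \<le> \<tau>" "\<tau> < 1"
  shows "(H_entropy b q \<longlongrightarrow> H_entropy b q \<tau>) (at_right \<tau>)"
proof -
  \<comment> \<open>At \<open>0\<close> the logarithm is not continuous, but
    \<open>x * log b x\<close> still tends to \<open>0\<close>; this matters for large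
    \<open>\<delta>\<close>, where the limit point is \<open>0\<close>.\<close>
  have xlogx: "((\<lambda>x. x * log b x) \<longlongrightarrow> \<tau> * log b \<tau>) (at_right \<tau>)"
  proof (cases "\<tau> = 0")
    case True
    have "((\<lambda>x::real. x * ln x) \<longlongrightarrow> 0) (at_right 0)" by real_asymp
    then have "((\<lambda>x::real. x * ln x / ln b) \<longlongrightarrow> 0 / ln b) (at_right 0)"
      by (intro tendsto_divide tendsto_const) (use assms in auto)
    then show ?thesis by (simp add: log_def True)
  next
    case False
    then show ?thesis using assms by (intro tendsto_intros) auto
  qed
  have "((\<lambda>x. x * log b (q - 1) - x * log b x - (1 - x) * log b (1 - x))
      \<longlongrightarrow> \<tau> * log b (q - 1) - \<tau> * log b \<tau> - (1 - \<tau>) * log b (1 - \<tau>)) (at_right \<tau>)"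
    using assms by (intro tendsto_intros xlogx) auto
  then show ?thesis by (simp add: H_entropy_def[abs_def])
qed

section \<open>Codes in the power graphs\<close>

lemma independence_number_attained:
  assumes "pair_graph H" "pverts H \<noteq> {}"
  obtains C where "independent_set H C" "C \<noteq> {}" "finite C" "card C = independence_number H"
proof -
  interpret pair_graph H by fact
  let ?I = "{S. independent_set H S}"
  have "?I \<subseteq> Pow (pverts H)" by (auto simp: independent_set_def)
  then have fin: "finite ?I" by (rule finite_subset) simp
  obtain v where "v \<in> pverts H" using assms(2) by auto
  moreover have "(v, v) \<notin> parcs H" using pair_no_loops by fastforce
  ultimately have v: "{v} \<in> ?I" by (auto simp: independent_set_def)
  then have "independence_number H \<in> card ` ?I"
    unfolding independence_number_def using fin by (intro Max_in) auto
  then obtain C where C: "independent_set H C" "card C = independence_number H" by auto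
  have "card {v} \<le> independence_number H"
    unfolding independence_number_def using fin v by (intro Max_ge finite_imageI imageI)
  then have "0 < card C" using C by simp
  then show ?thesis using that C by (metis card_gt_0_iff)
qed

lemma power_graph_simps:
  "pverts (power_graph G n d) = {..<n} \<rightarrow>\<^sub>E pverts G"
  "(x, y) \<in> parcs (power_graph G n d) \<longleftrightarrow> x \<in> {..<n} \<rightarrow>\<^sub>E pverts G \<and> y \<in> {..<n} \<rightarrow>\<^sub>E pverts G \<and>
    x \<noteq> y \<and> tuple_dist G n x y \<le> ereal d"
  by (simp_all add: power_graph_def Let_def)

lemma tuple_dist_eq_card:
  assumes "\<And>i. i < n \<Longrightarrow> x i \<noteq> y i \<Longrightarrow> (x i, y i) \<in> parcs G"
  shows "tuple_dist G n x y = ereal (real (card {i. i < n \<and> x i \<noteq> y i}))"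
proof -
  have "tuple_dist G n x y = (\<Sum>i<n. ereal (if x i \<noteq> y i then 1 else 0))"
    unfolding tuple_dist_def using assms by (intro sum.cong) (auto simp: vdist_def)
  also have "\<dots> = ereal (\<Sum>i<n. if x i \<noteq> y i then 1 else 0)" by (rule sum_ereal)
  also have "(\<Sum>i<n. if x i \<noteq> y i then 1 else 0 :: real) = real (card {i. i < n \<and> x i \<noteq> y i})"
    by (simp add: sum.If_cases lessThan_def Collect_conj_eq[symmetric])
  finally show ?thesis .
qed

lemma limsup_ereal_le:
  fixes f g :: "nat \<Rightarrow> real"
  assumes "\<forall>\<^sub>F n in sequentially. f n \<le> g n" "g \<longlonglongrightarrow> c"
  shows "limsup (\<lambda>n. ereal (f n)) \<le> ereal c"
proof -
  have "limsup (\<lambda>n. ereal (f n)) \<le> limsup (\<lambda>n. ereal (g n))"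
    using assms(1) by (intro Limsup_mono) simp
  also have "\<dots> = ereal c"
    using assms(2) by (intro lim_imp_Limsup) auto
  finally show ?thesis .
qed

lemma R_star_le:
  fixes G :: "'a pair_pre_digraph" and b \<delta> \<tau> :: real
  assumes G: "pair_graph G" "vertex_transitive G" "edge_transitive G" "edge_set G \<noteq> {}"
    and b: "1 < b" and \<delta>: "0 < \<delta>"
  defines "q \<equiv> real (card (pverts G)) / lovasz_theta G"
  assumes \<tau>: "0 < \<tau>" "\<tau> \<le> 1 - 1 / q"
    and strict: "q - 1 - q * \<delta> < (q - 2) * \<tau> + 2 * sqrt ((q - 1) * \<tau> * (1 - \<tau>))"
  shows "R_star b G \<delta> \<le> ereal (log b (lovasz_theta G) + H_entropy b q \<tau>)"
proof -
  let ?\<theta> = "lovasz_theta G" and ?H = "\<lambda>n. power_graph G n (\<delta> * real n)"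
  obtain B where "scheme_kernel (pverts G) B q ?\<theta>" and B0: "\<And>u v. (u, v) \<notin> parcs G \<Longrightarrow> B u v = 0"
    using scheme_kernel_transitive[OF G] unfolding q_def by blast
  then interpret scheme_kernel "pverts G" B q ?\<theta> by simp
  have "pverts G \<noteq> {}"
  proof -
    interpret pair_graph G by fact
    show ?thesis using G(4) in_arcsD1 by (fastforce simp: edge_set_def)
  qed
  then have ne: "pverts (?H n) \<noteq> {}" for n by (auto simp: power_graph_simps PiE_eq_empty_iff)
  have "\<forall>\<^sub>F n in sequentially. 1 / real n * log b (real (independence_number (?H n)))
      \<le> log b ?\<theta> + log b (q * \<delta> * real n) / real n + H_entropy b q \<tau>"
    using eventually_log_card_le[OF b \<delta> \<tau> strict]
  proof (rule eventually_mono)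
    fix n :: nat
    obtain C where C: "independent_set (?H n) C" "C \<noteq> {}" "finite C" "card C = independence_number (?H n)"
      using independence_number_attained[OF pair_graph_power_graph[OF G(1)] ne] .
    have mem: "C \<subseteq> {..<n} \<rightarrow>\<^sub>E pverts G"
      using C(1) by (simp add: independent_set_def power_graph_simps)
    \<comment> \<open>A distinct nonadjacent coordinate pair has \<open>B = 0\<close>. Without one,
      \<open>tuple_dist\<close> is the Hamming distance, which exceeds \<open>\<delta> n\<close> by
      independence.\<close>
    have sep: "(\<exists>i<n. x i \<noteq> y i \<and> B (x i) (y i) = 0) \<or>
        \<delta> * real n \<le> real (card {i. i < n \<and> x i \<noteq> y i})"
      if xy: "x \<in> C" "y \<in> C" "x \<noteq> y" for x y
    proof (cases "\<exists>i<n. x i \<noteq> y i \<and> (x i, y i) \<notin> parcs G")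
      case True
      then show ?thesis using B0 by blast
    next
      case False
      then have "tuple_dist G n x y = ereal (real (card {i. i < n \<and> x i \<noteq> y i}))"
        by (intro tuple_dist_eq_card) auto
      moreover have "\<not> tuple_dist G n x y \<le> ereal (\<delta> * real n)"
        using C(1) xy mem by (auto simp: independent_set_def power_graph_simps)
      ultimately show ?thesis by simp
    qed
    assume "\<forall>C. finite C \<longrightarrow> C \<noteq> {} \<longrightarrow> (\<forall>x\<in>C. \<forall>i<n. x i \<in> pverts G) \<longrightarrow>
      (\<forall>x\<in>C. \<forall>y\<in>C. x \<noteq> y \<longrightarrow> (\<exists>i<n. x i \<noteq> y i \<and> B (x i) (y i) = 0) \<or>
        \<delta> * real n \<le> real (card {i. i < n \<and> x i \<noteq> y i})) \<longrightarrow>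
      1 / real n * log b (real (card C)) \<le> log b ?\<theta> + log b (q * \<delta> * real n) / real n + H_entropy b q \<tau>"
    from this[rule_format, of C] show "1 / real n * log b (real (independence_number (?H n)))
      \<le> log b ?\<theta> + log b (q * \<delta> * real n) / real n + H_entropy b q \<tau>"
      using C mem sep by (auto simp: PiE_iff)
  qed
  moreover have "(\<lambda>n. log b ?\<theta> + log b (q * \<delta> * real n) / real n + H_entropy b q \<tau>)
      \<longlonglongrightarrow> log b ?\<theta> + 0 + H_entropy b q \<tau>"
  proof (intro tendsto_add tendsto_const)
    define c where "c = q * \<delta>"
    have "0 < c" using q \<delta> by (simp add: c_def)
    then have "(\<lambda>n. ln (c * real n) / real n) \<longlonglongrightarrow> 0" by real_asymp
    then have "(\<lambda>n. ln (c * real n) / real n / ln b) \<longlonglongrightarrow> 0 / ln b"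
      by (intro tendsto_divide tendsto_const) (use b in auto)
    then show "(\<lambda>n. log b (q * \<delta> * real n) / real n) \<longlonglongrightarrow> 0"
      by (simp add: log_def c_def mult.commute)
  qed
  ultimately have "R_star b G \<delta> \<le> ereal (log b ?\<theta> + 0 + H_entropy b q \<tau>)"
    unfolding R_star_def by (rule limsup_ereal_le)
  then show ?thesis by simp
qed

text \<open>Counting all tuples settles \<open>\<delta> = 0\<close>, where the factor
  \<open>q * d\<close> of the linear programming bound degenerates to \<open>0\<close>.\<close>

lemma R_star_zero_le:
  assumes G: "pair_graph G" and ne: "pverts G \<noteq> {}" and b: "1 < b"
  shows "R_star b G 0 \<le> ereal (log b (real (card (pverts G))))"
proof -
  interpret pair_graph G by fact
  let ?N = "card (pverts G)" and ?H = "\<lambda>n. power_graph G n (0 * real n)"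
  have "1 / real n * log b (real (independence_number (?H n))) \<le> log b (real ?N)" if n: "0 < n" for n
  proof -
    have "pverts (?H n) \<noteq> {}" using ne by (auto simp: power_graph_simps PiE_eq_empty_iff)
    then obtain C where C: "independent_set (?H n) C" "C \<noteq> {}" "finite C" "card C = independence_number (?H n)"
      using independence_number_attained[OF pair_graph_power_graph[OF G]] by blast
    have "C \<subseteq> {..<n} \<rightarrow>\<^sub>E pverts G"
      using C(1) by (simp add: independent_set_def power_graph_simps)
    then have "card C \<le> card ({..<n} \<rightarrow>\<^sub>E pverts G)" by (intro card_mono finite_PiE) auto
    also have "\<dots> = ?N ^ n" by (simp add: card_PiE)
    finally have "real (card C) \<le> real ?N ^ n" by (metis of_nat_le_iff of_nat_power)
    moreover have "0 < card C" using C(2,3) by (simp add: card_gt_0_iff)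
    moreover have "0 < ?N" using ne by (simp add: card_gt_0_iff)
    ultimately have "log b (real (card C)) \<le> log b (real ?N ^ n)"
      using b by (subst log_le_cancel_iff) auto
    also have "\<dots> = real n * log b (real ?N)" using \<open>0 < ?N\<close> by (simp add: log_nat_power)
    finally show ?thesis using n C(4) by (simp add: field_simps)
  qed
  then have "\<forall>\<^sub>F n in sequentially. 1 / real n * log b (real (independence_number (?H n))) \<le> log b (real ?N)"
    using eventually_gt_at_top[of "0::nat"] by (rule eventually_mono[rotated])
  then show ?thesis
    unfolding R_star_def by (rule limsup_ereal_le) (rule tendsto_const)
qed

theorem theorem2:
  fixes G :: "'a pair_pre_digraph" and b \<delta> :: real
  assumes "pair_graph G"
    and "vertex_transitive G"
    and "edge_transitive G"
    and "edge_set G \<noteq> {}"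
    and "b > 1"
    and "0 \<le> \<delta>" and "\<delta> \<le> 1"
  shows "R_star b G \<delta> \<le>
    ereal (log b (lovasz_theta G) + R_LP1 b (real (card (pverts G)) / lovasz_theta G) \<delta>)"
proof -
  let ?\<theta> = "lovasz_theta G" and ?N = "real (card (pverts G))"
  define q where "q = ?N / ?\<theta>"
  have \<theta>: "1 \<le> ?\<theta>" "2 * ?\<theta> \<le> ?N"
    using lovasz_theta_transitive[OF assms(1-4)] by blast+
  have q: "2 \<le> q" using \<theta> by (simp add: q_def field_simps)
  have ne: "pverts G \<noteq> {}" using \<theta> by auto
  have "R_star b G \<delta> \<le> ereal (log b ?\<theta> + R_LP1 b q \<delta>)"
  proof (cases "\<delta> = 0")
    case True
    \<comment> \<open>At \<open>\<delta> = 0\<close> the entropy is taken at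
      \<open>1 - 1 / q\<close>, so the claimed bound is just \<open>log b ?N\<close>.\<close>
    have "R_LP1 b q 0 = log b q"
    proof -
      have e: "(q - 1) / q = 1 - 1 / q" using q by (simp add: field_simps)
      have "log b (1 - 1 / q) = log b (q - 1) - log b q"
        using q assms(5) by (simp add: log_divide_pos flip: e)
      moreover have "log b (1 / q) = - log b q"
        using q assms(5) by (simp add: log_divide_pos)
      ultimately have "H_entropy b q (1 - 1 / q) = (1 - 1 / q) * log b (q - 1)
          - (1 - 1 / q) * (log b (q - 1) - log b q) - (1 / q) * (- log b q)"
        by (simp add: H_entropy_def)
      also have "\<dots> = log b q" by (simp add: left_diff_distrib right_diff_distrib)
      finally show ?thesis using q by (simp add: R_LP1_def e)
    qed
    moreover have "log b ?\<theta> + log b q = log b ?N"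
      using \<theta> assms(5) by (simp add: q_def log_divide_pos)
    ultimately show ?thesis
      using R_star_zero_le[OF assms(1) ne assms(5)] True by simp
  next
    case False
    with assms(6) have \<delta>: "0 < \<delta>" by simp
    \<comment> \<open>Beyond \<open>1 - 1 / q\<close> the choice \<open>\<tau> = 0\<close> fits, as
      the entropy vanishes there. The last condition then reads
      \<open>q - 1 \<le> q * \<delta>\<close> up to square roots.\<close>
    obtain \<tau> where \<tau>: "0 \<le> \<tau>" "\<tau> < 1 - 1 / q" "R_LP1 b q \<delta> = H_entropy b q \<tau>"
      "sqrt ((q - 1) * (1 - \<tau>)) - sqrt \<tau> \<le> sqrt (q * \<delta>)"
    proof (cases "\<delta> < 1 - 1 / q")
      case True
      with LP1_critical_point[OF q \<delta> True] show ?thesis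
        by (intro that) (auto simp: R_LP1_def)
    next
      case False
      then have "q - 1 \<le> q * \<delta>" using q by (simp add: field_simps)
      with False q show ?thesis
        by (intro that[of 0]) (auto simp: R_LP1_def H_entropy_def)
    qed
    \<comment> \<open>The bound needs a strict inequality, available only to the right of
      \<open>\<tau>\<close>; the limit from the right then yields it at
      \<open>\<tau>\<close>.\<close>
    have "R_star b G \<delta> \<le> ereal (log b ?\<theta> + H_entropy b q \<tau>')" if "\<tau> < \<tau>'" "\<tau>' < 1 - 1 / q" for \<tau>'
    proof (rule R_star_le[OF assms(1-5) \<delta>, folded q_def])
      show "q - 1 - q * \<delta> < (q - 2) * \<tau>' + 2 * sqrt ((q - 1) * \<tau>' * (1 - \<tau>'))"
        using that by (intro LP1_threshold[OF q \<tau>(1) _ _ \<tau>(4) \<delta>]) auto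
    qed (use that \<tau> in auto)
    then have "\<forall>\<^sub>F \<tau>' in at_right \<tau>. R_star b G \<delta> \<le> ereal (log b ?\<theta> + H_entropy b q \<tau>')"
      using \<tau>(2) by (auto simp: eventually_at_right_field)
    moreover have "((\<lambda>\<tau>'. ereal (log b ?\<theta> + H_entropy b q \<tau>')) \<longlongrightarrow> ereal (log b ?\<theta> + H_entropy b q \<tau>)) (at_right \<tau>)"
    proof -
      have "0 < 1 / q" using q by simp
      then have "\<tau> < 1" using \<tau>(2) by linarith
      then show ?thesis
        by (intro tendsto_ereal tendsto_add tendsto_const tendsto_H_entropy_at_right assms \<tau>)
    qed
    ultimately show ?thesis
      unfolding \<tau>(3) by (intro tendsto_lowerbound) auto
  qed
  then show ?thesis unfolding q_def .
qed

end
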